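(* Let $U$ be a $C^\infty$ potential on $\mathbb{R}^n$ such that $\mu(dx)=\frac1{Z_U}e^{-U(x)}dx$ is a probability measure. Let $\beta\ge1$, $K>0$ and $\alpha(a)=\min(a^\beta,1)$, and assume that for all $x,y$ and all $\varepsilon>0$, $$\langle\nabla U(x)-\nabla U(y),x-y\rangle\ge K\alpha(\varepsilon)(|x-y|^2-\varepsilon).$$ Then $\mu$ satisfies a Poincaré inequality with constant $$C_P(\mu)\le\max\Big(\frac{32}K,\ 4\,(36)^{\frac{2\beta+1}{\beta+1}}\Big(\frac{32}{K^2}\Big)^{\frac1{2(\beta+1)}}\Big),$$ and a log-Sobolev inequality with constant $$C_{LS}(\mu)\le\max\Big(\frac{32}K,\ \Big(\frac{32}{K^2}\Big)^{\frac1{2(\beta+1)}}\Big(4^{\frac{3\beta+1}{2\beta+1}}36^{\frac\beta{\beta+1}}+8\times36^{\frac{2\beta+1}{\beta+1}}\Big)\Big).$$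
   Context: Poincaré inequality with constant $C_P$: $\mathrm{Var}_\mu(f)\le C_P\int|\nabla f|^2d\mu$. Log-Sobolev inequality with constant $C_{LS}$: $\int f^2\log f^2d\mu-\int f^2d\mu\log\int f^2d\mu\le C_{LS}\int|\nabla f|^2d\mu$. *)

theory Defs
  imports "HOL-Analysis.Analysis" "HOL-Probability.Probability"
begin

definition partial_deriv :: "'n::finite \<Rightarrow> (real^'n \<Rightarrow> real) \<Rightarrow> real^'n \<Rightarrow> real" where
  "partial_deriv i f x = deriv (\<lambda>t. f (x + t *\<^sub>R axis i 1)) 0"

definition smooth_fun :: "(real^'n::finite \<Rightarrow> real) \<Rightarrow> bool" where
  "smooth_fun f \<longleftrightarrow>
     (\<forall>is::'n list. continuous_on UNIV (foldr partial_deriv is f) \<and>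
        (\<forall>i x. (\<lambda>t. foldr partial_deriv is f (x + t *\<^sub>R axis i 1)) differentiable (at 0)))"

definition gibbs :: "(real^'n::finite \<Rightarrow> real) \<Rightarrow> (real^'n) measure" where
  "gibbs U = density lborel (\<lambda>x. ennreal (exp (- U x) / integral\<^sup>L lborel (\<lambda>y. exp (- U y))))"

definition test_fun :: "(real^'n::finite) measure \<Rightarrow> (real^'n \<Rightarrow> real) \<Rightarrow> (real^'n \<Rightarrow> real^'n) \<Rightarrow> bool" where
  "test_fun M f gf \<longleftrightarrow> (\<forall>x. GDERIV f x :> gf x) \<and> continuous_on UNIV gf \<and>
     integrable M (\<lambda>x. (f x)\<^sup>2) \<and> integrable M (\<lambda>x. (norm (gf x))\<^sup>2)"

definition poincare_ineq :: "(real^'n::finite) measure \<Rightarrow> real \<Rightarrow> bool" where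
  "poincare_ineq M C \<longleftrightarrow> (\<forall>f gf. test_fun M f gf \<longrightarrow>
     (\<integral>x. (f x)\<^sup>2 \<partial>M) - (\<integral>x. f x \<partial>M)\<^sup>2 \<le> C * (\<integral>x. (norm (gf x))\<^sup>2 \<partial>M))"

definition log_sobolev_ineq :: "(real^'n::finite) measure \<Rightarrow> real \<Rightarrow> bool" where
  "log_sobolev_ineq M C \<longleftrightarrow> (\<forall>f gf. test_fun M f gf \<longrightarrow>
     integrable M (\<lambda>x. (f x)\<^sup>2 * ln ((f x)\<^sup>2)) \<longrightarrow>
     (\<integral>x. (f x)\<^sup>2 * ln ((f x)\<^sup>2) \<partial>M) - (\<integral>x. (f x)\<^sup>2 \<partial>M) * ln (\<integral>x. (f x)\<^sup>2 \<partial>M)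
       \<le> C * (\<integral>x. (norm (gf x))\<^sup>2 \<partial>M))"

end

theory Submission
  imports Defs
begin

text \<open>
  With \<open>\<kappa> = K min(\<epsilon>\<^sup>\<beta>, 1)\<close> the hypothesis makes \<open>U\<close> convex with a quadratic modulus up to an additive
  defect of order \<open>\<kappa> \<epsilon>\<close>. Applied to perturbations of \<open>e\<^sup>-\<^sup>U\<close> as in the argument of Bobkov and Ledoux, the
  Prekopa-Leindler inequality then yields a defective logarithmic Sobolev inequality
  \<open>Ent(f\<^sup>2) \<le> A \<integral> |\<nabla>f|\<^sup>2 + D \<integral> f\<^sup>2\<close> with \<open>A\<close> of order \<open>1/\<kappa>\<close> and \<open>D\<close> of order \<open>\<kappa> \<epsilon>\<close>.

  A function supported on a set of measure at most \<open>1/2\<close> has \<open>Ent(f\<^sup>2) \<ge> ln 2 \<integral> f\<^sup>2\<close>. Hence once \<open>D < ln 2\<close>,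
  applying the defective inequality to the positive and negative parts of \<open>f\<close> minus a median gives the Poincare
  inequality. The Poincare inequality in turn tightens the defective inequality: if \<open>\<integral> f\<^sup>2 = 1\<close> and
  \<open>\<integral> f \<ge> 0\<close>, the entropy of \<open>f\<^sup>2\<close> is controlled by that of \<open>(f - 1)\<^sup>2\<close> and by
  \<open>\<integral> (f - 1)\<^sup>2 \<le> 2 Var(f)\<close>. The constants follow from \<open>\<epsilon> = 1\<close> if \<open>K \<le> 1/100\<close>, and otherwise from
  the \<open>\<epsilon>\<close> with \<open>K \<epsilon>\<^sup>\<beta>\<^sup>+\<^sup>1 = 1/100\<close>.
\<close>

subsection \<open>The Prekopa-Leindler inequality\<close>

text \<open>At a fixed \<epsilon> the hypothesis is empty for points closer than
  \<open>sqrt \<epsilon>\<close>, so it yields no positive lower bound on the Hessian of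
  \<open>U\<close> and the usual curvature criterion is out of reach. Prekopa-Leindler sees only the
  integrated gap \<open>t U(x) + s U(y) - U(t x + s y)\<close>. This gap tolerates an additive error
  \<open>t s D\<close>, which is of first order at \<open>s = 0\<close> and therefore ends up as the
  defect \<open>D\<close>. At short distance the gap is controlled by monotonicity of the gradient,
  obtained from the choice \<open>\<epsilon> = |x - y|^2\<close>. This leaves an error linear in
  \<open>|x - y|\<close>, absorbed by giving up a tenth of the quadratic term; whence
  \<open>\<rho> = 9/10 \<kappa>\<close> and \<open>D = 5 \<kappa> \<epsilon>\<close>. The numerical
  constants form one budget: 13/20 is a rational stand-in for \<open>ln 2\<close>, and
  \<open>\<kappa> \<epsilon> <= 1/100\<close> makes \<open>D <= 1/20\<close>, which leaves a margin
  of 3/5 to divide by.\<close>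

lemma measure_sumset_compact_ge:
  fixes A B C :: "real set"
  assumes AB: "compact A" "compact B" "A \<noteq> {}" "B \<noteq> {}" and C: "C \<in> lmeasurable"
    and t: "t > 0" and s: "s > 0"
    and sub: "\<And>a b. a \<in> A \<Longrightarrow> b \<in> B \<Longrightarrow> t * a + s * b \<in> C"
  shows "t * measure lebesgue A + s * measure lebesgue B \<le> measure lebesgue C"
proof -
  obtain a0 where a0: "a0 \<in> A" "\<And>a. a \<in> A \<Longrightarrow> a \<le> a0"
    using compact_attains_sup[OF AB(1,3)] by blast
  obtain b0 where b0: "b0 \<in> B" "\<And>b. b \<in> B \<Longrightarrow> b0 \<le> b"
    using compact_attains_inf[OF AB(2,4)] by blast
  \<comment> \<open>\<open>t A\<close> is shifted to end at \<open>t a0 + s b0\<close> and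
    \<open>s B\<close> to start there. The two copies share at most that point and both lie in
    \<open>C\<close>, so their measures add.\<close>
  define P where "P = (\<lambda>x. t *\<^sub>R x + s * b0) ` A"
  define Q where "Q = (\<lambda>x. s *\<^sub>R x + t * a0) ` B"
  have mP: "measure lebesgue P = t * measure lebesgue A"
    unfolding P_def using measure_lebesgue_affine[of t "s * b0" A] t by simp
  have mQ: "measure lebesgue Q = s * measure lebesgue B"
    unfolding Q_def using measure_lebesgue_affine[of s "t * a0" B] s by simp
  have cP: "compact P" unfolding P_def by (intro compact_continuous_image continuous_intros AB)
  have cQ: "compact Q" unfolding Q_def by (intro compact_continuous_image continuous_intros AB)
  have PQ: "P \<inter> Q \<subseteq> {t * a0 + s * b0}"
  proof
    fix x assume "x \<in> P \<inter> Q"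
    then obtain a b where "a \<in> A" "b \<in> B" "x = t * a + s * b0" "x = s * b + t * a0"
      unfolding P_def Q_def by auto
    moreover have "t * a \<le> t * a0" "s * b0 \<le> s * b"
      using a0 b0 calculation t s by (auto intro!: mult_left_mono)
    ultimately have "x = t * a0 + s * b0" by linarith
    then show "x \<in> {t * a0 + s * b0}" by simp
  qed
  have neg: "negligible (P \<inter> Q)"
    using PQ negligible_subset negligible_sing by blast
  have "measure lebesgue (P \<union> Q) = measure lebesgue P + measure lebesgue Q"
    using measure_Un3_negligible[of P Q "{}" "P \<union> Q"] neg cP cQ
    by (simp add: lmeasurable_compact)
  moreover have "measure lebesgue (P \<union> Q) \<le> measure lebesgue C"
  proof (rule measure_mono_fmeasurable)
    show "P \<union> Q \<subseteq> C" unfolding P_def Q_def using sub a0 b0 by (auto simp: add.commute)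
    show "P \<union> Q \<in> sets lebesgue" using cP cQ lmeasurable_compact by blast
  qed fact
  ultimately show ?thesis using mP mQ by simp
qed

lemma inner_compact_bounded:
  fixes A :: "'a::euclidean_space set"
  assumes A: "A \<in> sets lebesgue" "bounded A" "A \<noteq> {}" and e: "e > 0"
  obtains T where "compact T" "T \<subseteq> A" "T \<noteq> {}" "measure lebesgue A \<le> measure lebesgue T + e"
proof -
  obtain T where T: "closed T" "T \<subseteq> A" "A - T \<in> lmeasurable" "emeasure lebesgue (A - T) < ennreal e"
    using sets_lebesgue_inner_closed[OF A(1) e] by metis
  obtain a where a: "a \<in> A" using A by auto
  \<comment> \<open>The adjoined point keeps the compact set nonempty; \<open>T\<close> alone may be
    empty when \<open>A\<close> has measure below \<open>e\<close>.\<close>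
  have cT: "compact (insert a T)"
    using T A(2) bounded_subset by (intro compact_insert) (auto simp: compact_eq_bounded_closed)
  have "measure lebesgue (A - T) < e"
    using T(4) unfolding emeasure_eq_measure2[OF T(3)] by (simp add: ennreal_less_iff)
  moreover have "measure lebesgue A \<le> measure lebesgue (insert a T) + measure lebesgue (A - T)"
  proof -
    have m: "A = T \<union> (A - T)" using T by auto
    have "measure lebesgue A \<le> measure lebesgue (T) + measure lebesgue (A - T)"
      by (subst m, rule measure_Un_le) (use T in auto)
    moreover have "measure lebesgue T \<le> measure lebesgue (insert a T)"
      by (rule measure_mono_fmeasurable) (use cT lmeasurable_compact T in auto)
    ultimately show ?thesis by simp
  qed
  ultimately show ?thesis
    by (intro that[of "insert a T"]) (use cT T a in auto)
qed

text \<open>The sum of two measurable sets need not be measurable, hence the formulation with a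
  measurable superset \<open>C\<close>. Compact inner approximation loses \<open>e / (t + s)\<close>
  for each set, which the weights turn into a total loss of \<open>e\<close>.\<close>

lemma measure_sumset_ge:
  fixes A B C :: "real set"
  assumes A: "A \<in> sets lebesgue" "bounded A" "A \<noteq> {}" and B: "B \<in> sets lebesgue" "bounded B" "B \<noteq> {}"
    and C: "C \<in> lmeasurable" and t: "t > 0" and s: "s > 0"
    and sub: "\<And>a b. a \<in> A \<Longrightarrow> b \<in> B \<Longrightarrow> t * a + s * b \<in> C"
  shows "t * measure lebesgue A + s * measure lebesgue B \<le> measure lebesgue C"
proof (rule field_le_epsilon)
  fix e :: real assume e: "e > 0"
  obtain T where T: "compact T" "T \<subseteq> A" "T \<noteq> {}" "measure lebesgue A \<le> measure lebesgue T + e / (t + s)"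
    by (rule inner_compact_bounded[OF A, of "e / (t + s)"]) (use e t s in auto)
  obtain S where S: "compact S" "S \<subseteq> B" "S \<noteq> {}" "measure lebesgue B \<le> measure lebesgue S + e / (t + s)"
    by (rule inner_compact_bounded[OF B, of "e / (t + s)"]) (use e t s in auto)
  have "t * measure lebesgue T + s * measure lebesgue S \<le> measure lebesgue C"
    by (rule measure_sumset_compact_ge) (use T S C t s sub in auto)
  moreover have "t * measure lebesgue A \<le> t * (measure lebesgue T + e / (t + s))"
    using T t by (intro mult_left_mono) auto
  moreover have "s * measure lebesgue B \<le> s * (measure lebesgue S + e / (t + s))"
    using S s by (intro mult_left_mono) auto
  moreover have "t * (e / (t + s)) + s * (e / (t + s)) = e"
    using t s by (metis add_pos_pos distrib_right nonzero_mult_div_cancel_left order_less_irrefl times_divide_eq_right)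
  ultimately show "t * measure lebesgue A + s * measure lebesgue B \<le> measure lebesgue C + e"
    by (simp add: algebra_simps)
qed

section \<open>From sets to functions in dimension one\<close>

text \<open>Layer-cake formula by Tonelli, since \<open>u x\<close> is the length of
  \<open>{0..<u x}\<close>. It lets an inequality between superlevel sets at every height be
  integrated into one between functions.\<close>

lemma nn_integral_superlevel:
  fixes u :: "'a \<Rightarrow> real"
  assumes [measurable]: "u \<in> borel_measurable M" and M: "sigma_finite_measure M" and u: "\<And>x. 0 \<le> u x"
  shows "(\<integral>\<^sup>+x. ennreal (u x) \<partial>M) =
     (\<integral>\<^sup>+l. indicator {0..} l * emeasure M {x \<in> space M. l < u x} \<partial>lborel)"
proof -
  interpret M: sigma_finite_measure M by fact
  interpret P: pair_sigma_finite M "lborel :: real measure"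
    by standard
  have "(\<integral>\<^sup>+x. ennreal (u x) \<partial>M) = (\<integral>\<^sup>+x. (\<integral>\<^sup>+l. indicator {0..<u x} l \<partial>lborel) \<partial>M)"
    using u by simp
  also have "\<dots> = (\<integral>\<^sup>+x. (\<integral>\<^sup>+l. indicator {p \<in> space (M \<Otimes>\<^sub>M lborel). 0 \<le> snd p \<and> snd p < u (fst p)} (x, l) \<partial>lborel) \<partial>M)"
    by (intro nn_integral_cong) (auto simp: space_pair_measure split: split_indicator)
  also have "\<dots> = (\<integral>\<^sup>+l. (\<integral>\<^sup>+x. indicator {p \<in> space (M \<Otimes>\<^sub>M lborel). 0 \<le> snd p \<and> snd p < u (fst p)} (x, l) \<partial>M) \<partial>lborel)"
    by (subst P.Fubini') auto
  also have "\<dots> = (\<integral>\<^sup>+l. (\<integral>\<^sup>+x. indicator {0..} l * indicator {x \<in> space M. l < u x} x \<partial>M) \<partial>lborel)"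
    by (intro nn_integral_cong) (auto simp: space_pair_measure split: split_indicator)
  also have "\<dots> = (\<integral>\<^sup>+l. indicator {0..} l * emeasure M {x \<in> space M. l < u x} \<partial>lborel)"
    by (simp add: nn_integral_cmult)
  finally show ?thesis .
qed

text \<open>With both suprema equal to 1, the superlevel sets of \<open>u\<close> and
  \<open>v\<close> are both nonempty for \<open>l < 1\<close> and both empty otherwise, so the set
  inequality is available at every relevant height. It yields an arithmetic mean on the left, which
  would be false in general without the normalisation.\<close>

lemma prekopa_leindler_real_normalized:
  fixes u v w :: "real \<Rightarrow> real"
  assumes [measurable]: "u \<in> borel_measurable borel" "v \<in> borel_measurable borel" "w \<in> borel_measurable borel"
    and pos: "\<And>x. 0 \<le> u x" "\<And>x. 0 \<le> v x" "\<And>x. 0 \<le> w x"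
    and le1: "\<And>x. u x \<le> 1" "\<And>x. v x \<le> 1"
    and sup1: "\<And>l. l < 1 \<Longrightarrow> \<exists>x. l < u x" "\<And>l. l < 1 \<Longrightarrow> \<exists>x. l < v x"
    and supp: "\<And>x. x \<notin> {-R..R} \<Longrightarrow> u x = 0" "\<And>x. x \<notin> {-R..R} \<Longrightarrow> v x = 0" "\<And>x. x \<notin> {-R..R} \<Longrightarrow> w x = 0"
    and ts: "t > 0" "s > 0" "t + s = 1"
    and H: "\<And>x y. u x powr t * v y powr s \<le> w (t * x + s * y)"
  shows "ennreal t * (\<integral>\<^sup>+x. ennreal (u x) \<partial>lborel) + ennreal s * (\<integral>\<^sup>+x. ennreal (v x) \<partial>lborel)
    \<le> (\<integral>\<^sup>+x. ennreal (w x) \<partial>lborel)"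
proof -
  have key: "ennreal t * emeasure lborel {x \<in> space lborel. l < u x} + ennreal s * emeasure lborel {x \<in> space lborel. l < v x}
      \<le> emeasure lborel {x \<in> space lborel. l < w x}" if l: "0 \<le> l" for l
  proof (cases "l < 1")
    case True
    have sub: "{x. l < u x} \<subseteq> {-R..R}" "{x. l < v x} \<subseteq> {-R..R}" "{x. l < w x} \<subseteq> {-R..R}"
      using supp l by (auto simp: not_less[symmetric])
    have fm: "{x. l < u x} \<in> lmeasurable" "{x. l < v x} \<in> lmeasurable" "{x. l < w x} \<in> lmeasurable"
      using sub by (auto intro!: bounded_set_imp_lmeasurable bounded_subset[OF bounded_closed_interval])
    have "t * measure lebesgue {x. l < u x} + s * measure lebesgue {x. l < v x} \<le> measure lebesgue {x. l < w x}"
    proof (rule measure_sumset_ge)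
      fix a b assume "a \<in> {x. l < u x}" "b \<in> {x. l < v x}"
      then have ab: "l < u a" "l < v b" by auto
      \<comment> \<open>A weighted geometric mean of two numbers above \<open>l\<close> exceeds
        \<open>l\<close>; this places the weighted sum of the two superlevel sets inside that of
        \<open>w\<close>.\<close>
      have "l < u a powr t * v b powr s"
      proof (cases "l = 0")
        case True then show ?thesis using ab by simp
      next
        case False
        have "l = l powr t * l powr s" using ts l False by (simp add: powr_add[symmetric])
        also have "\<dots> < u a powr t * v b powr s"
          using ab ts l False by (intro mult_strict_mono powr_less_mono2) auto
        finally show ?thesis .
      qed
      then show "t * a + s * b \<in> {x. l < w x}" using H[of a b] by auto
    qed (use sub sup1 True ts fm in \<open>auto intro: bounded_subset[OF bounded_closed_interval] fmeasurableD\<close>)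
    moreover have "emeasure lborel {x \<in> space lborel. l < f x} = ennreal (measure lebesgue {x. l < f x})"
      if "f \<in> borel_measurable borel" "{x. l < f x} \<in> lmeasurable" for f :: "real \<Rightarrow> real"
      using emeasure_eq_measure2[OF that(2)] that(1) by simp
    ultimately show ?thesis
      using fm ts by (simp add: ennreal_mult[symmetric] ennreal_plus[symmetric] ennreal_leI del: ennreal_plus)
  next
    case False
    have "{x \<in> space lborel. l < u x} = {}" "{x \<in> space lborel. l < v x} = {}"
      using False le1 by (auto simp: not_less) (meson order_trans)+
    then show ?thesis by simp
  qed
  have "ennreal t * (\<integral>\<^sup>+x. ennreal (u x) \<partial>lborel) + ennreal s * (\<integral>\<^sup>+x. ennreal (v x) \<partial>lborel)
    = (\<integral>\<^sup>+l. indicator {0..} l * (ennreal t * emeasure lborel {x \<in> space lborel. l < u x}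
         + ennreal s * emeasure lborel {x \<in> space lborel. l < v x}) \<partial>lborel)"
    by (simp add: nn_integral_superlevel[OF _ _ pos(1)] nn_integral_superlevel[OF _ _ pos(2)]
        lborel.sigma_finite_measure_axioms nn_integral_cmult[symmetric] nn_integral_add[symmetric] algebra_simps)
  also have "\<dots> \<le> (\<integral>\<^sup>+l. indicator {0..} l * emeasure lborel {x \<in> space lborel. l < w x} \<partial>lborel)"
    by (intro nn_integral_mono) (use key in \<open>auto split: split_indicator\<close>)
  also have "\<dots> = (\<integral>\<^sup>+x. ennreal (w x) \<partial>lborel)"
    by (subst nn_integral_superlevel[OF _ _ pos(3)]) (auto intro: lborel.sigma_finite_measure_axioms)
  finally show ?thesis .
qed

lemma weighted_AM_GM:
  fixes a b :: real
  assumes "t > 0" "s > 0" "t + s = 1" "a \<ge> 0" "b \<ge> 0"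
  shows "a powr t * b powr s \<le> t * a + s * b"
  using Youngs_inequality_0[of t s a b] assms by (cases "a = 0 \<or> b = 0") auto

lemma integrable_bounded_support:
  fixes u :: "'a::euclidean_space \<Rightarrow> real"
  assumes "u \<in> borel_measurable borel" "\<And>x. 0 \<le> u x" "\<And>x. u x \<le> c" "\<And>x. x \<notin> cbox a b \<Longrightarrow> u x = 0"
  shows "integrable lborel u"
proof (rule Bochner_Integration.integrable_bound)
  show "integrable lborel (\<lambda>x. c * indicator (cbox a b) x)"
    by (intro integrable_mult_right integrable_real_indicator) (auto simp: emeasure_lborel_cbox_eq)
  show "AE x in lborel. norm (u x) \<le> norm (c * indicator (cbox a b) x)"
    using assms by (intro AE_I2) (auto split: split_indicator, metis abs_ge_self order_trans)
qed (use assms in simp)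

text \<open>Dividing \<open>u\<close>, \<open>v\<close> by their suprema \<open>a\<close>,
  \<open>b\<close> and \<open>w\<close> by \<open>e = a^t b^s\<close> preserves the hypothesis and
  reduces to the normalised case. Weighted AM-GM then replaces the arithmetic mean by a geometric
  one, for which the scaling factors cancel.\<close>

lemma prekopa_leindler_real:
  fixes u v w :: "real \<Rightarrow> real"
  assumes m[measurable]: "u \<in> borel_measurable borel" "v \<in> borel_measurable borel" "w \<in> borel_measurable borel"
    and pos: "\<And>x. 0 \<le> u x" "\<And>x. 0 \<le> v x" "\<And>x. 0 \<le> w x"
    and bd: "\<And>x. u x \<le> c" "\<And>x. v x \<le> c" "\<And>x. w x \<le> c"
    and supp: "\<And>x. x \<notin> {-R..R} \<Longrightarrow> u x = 0" "\<And>x. x \<notin> {-R..R} \<Longrightarrow> v x = 0" "\<And>x. x \<notin> {-R..R} \<Longrightarrow> w x = 0"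
    and ts: "t > 0" "s > 0" "t + s = 1"
    and H: "\<And>x y. u x powr t * v y powr s \<le> w (t * x + s * y)"
  shows "(\<integral>x. u x \<partial>lborel) powr t * (\<integral>x. v x \<partial>lborel) powr s \<le> (\<integral>x. w x \<partial>lborel)"
proof (cases "(\<forall>x. u x = 0) \<or> (\<forall>x. v x = 0)")
  case True
  then have "(\<integral>x. u x \<partial>lborel) powr t * (\<integral>x. v x \<partial>lborel) powr s = 0"
    by (metis Bochner_Integration.integral_cong integral_zero mult_eq_0_iff powr_0)
  also have "0 \<le> (\<integral>x. w x \<partial>lborel)" using pos by simp
  finally show ?thesis .
next
  case False
  then obtain x0 y0 where x0: "u x0 > 0" "v y0 > 0" using pos by (metis less_eq_real_def)
  define a b where "a = Sup (range u)" and "b = Sup (range v)"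
  have bdd: "bdd_above (range u)" "bdd_above (range v)" using bd by (auto intro!: bdd_aboveI2)
  have ab: "a > 0" "b > 0" unfolding a_def b_def
    using x0 cSUP_upper2[OF bdd(1), of x0 "u x0"] cSUP_upper2[OF bdd(2), of y0 "v y0"] by auto
  have ua: "u x \<le> a" "v x \<le> b" for x unfolding a_def b_def
    using cSUP_upper[OF _ bdd(1)] cSUP_upper[OF _ bdd(2)] by auto
  define e where "e = a powr t * b powr s"
  have e: "e > 0" unfolding e_def using ab by simp
  have iu: "integrable lborel u" "integrable lborel v" "integrable lborel w"
    using integrable_bounded_support[of u c "-R" R] integrable_bounded_support[of v c "-R" R]
       integrable_bounded_support[of w c "-R" R] pos bd supp by auto
  have "ennreal t * (\<integral>\<^sup>+x. ennreal (u x / a) \<partial>lborel) + ennreal s * (\<integral>\<^sup>+x. ennreal (v x / b) \<partial>lborel)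
    \<le> (\<integral>\<^sup>+x. ennreal (w x / e) \<partial>lborel)"
  proof (rule prekopa_leindler_real_normalized[where R = R])
    show "\<exists>x. l < u x / a" if "l < 1" for l
      using less_cSUP_iff[OF _ bdd(1), of "l * a"] that ab by (auto simp: field_simps a_def)
    show "\<exists>x. l < v x / b" if "l < 1" for l
      using less_cSUP_iff[OF _ bdd(2), of "l * b"] that ab by (auto simp: field_simps b_def)
    show "(u x / a) powr t * (v y / b) powr s \<le> w (t * x + s * y) / e" for x y
      using H[of x y] pos ab e by (simp add: powr_divide e_def divide_right_mono)
  qed (use ab e pos ua supp ts in auto)
  also have "(\<integral>\<^sup>+x. ennreal (u x / a) \<partial>lborel) = ennreal ((\<integral>x. u x \<partial>lborel) / a)"
    using iu pos ab by (subst nn_integral_eq_integral) auto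
  also have "(\<integral>\<^sup>+x. ennreal (v x / b) \<partial>lborel) = ennreal ((\<integral>x. v x \<partial>lborel) / b)"
    using iu pos ab by (subst nn_integral_eq_integral) auto
  also have "(\<integral>\<^sup>+x. ennreal (w x / e) \<partial>lborel) = ennreal ((\<integral>x. w x \<partial>lborel) / e)"
    using iu pos e by (subst nn_integral_eq_integral) auto
  finally have "t * ((\<integral>x. u x \<partial>lborel) / a) + s * ((\<integral>x. v x \<partial>lborel) / b) \<le> (\<integral>x. w x \<partial>lborel) / e"
    using ts ab e pos
    by (simp add: ennreal_mult[symmetric] ennreal_plus[symmetric] del: ennreal_plus)
  moreover have "((\<integral>x. u x \<partial>lborel) / a) powr t * ((\<integral>x. v x \<partial>lborel) / b) powr s \<le> t * ((\<integral>x. u x \<partial>lborel) / a) + s * ((\<integral>x. v x \<partial>lborel) / b)"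
    using ts ab pos by (intro weighted_AM_GM) auto
  moreover have "((\<integral>x. u x \<partial>lborel) / a) powr t * ((\<integral>x. v x \<partial>lborel) / b) powr s
     = (\<integral>x. u x \<partial>lborel) powr t * (\<integral>x. v x \<partial>lborel) powr s / e"
    using ab pos by (simp add: powr_divide e_def)
  ultimately have "(\<integral>x. u x \<partial>lborel) powr t * (\<integral>x. v x \<partial>lborel) powr s / e \<le> (\<integral>x. w x \<partial>lborel) / e"
    by linarith
  then show ?thesis using e by (simp add: divide_le_cancel)
qed

section \<open>Induction on the dimension\<close>

lemma integrable_PiM_bounded_support:
  fixes u :: "('i \<Rightarrow> real) \<Rightarrow> real"
  assumes I: "finite I" and m: "u \<in> borel_measurable (\<Pi>\<^sub>M i\<in>I. lborel)"
    and pos: "\<And>x. 0 \<le> u x" and bd: "\<And>x. u x \<le> c"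
    and supp: "\<And>x. \<exists>i\<in>I. x i \<notin> {-R..R} \<Longrightarrow> u x = 0"
  shows "integrable (\<Pi>\<^sub>M i\<in>I. lborel) u"
proof (rule Bochner_Integration.integrable_bound)
  interpret product_sigma_finite "\<lambda>i::'i. lborel :: real measure" by standard
  have "emeasure (\<Pi>\<^sub>M i\<in>I. lborel) (\<Pi>\<^sub>E i\<in>I. {-R..R}) < \<infinity>"
    using I by (subst emeasure_PiM) (auto simp: emeasure_lborel_Icc_eq power_less_top_ennreal)
  then show "integrable (\<Pi>\<^sub>M i\<in>I. lborel) (\<lambda>x. c * indicator (\<Pi>\<^sub>E i\<in>I. {-R..R}) x)"
    using I by (intro integrable_mult_right integrable_real_indicator sets_PiM_I_finite) auto
  show "AE x in \<Pi>\<^sub>M i\<in>I. lborel. norm (u x) \<le> norm (c * indicator (\<Pi>\<^sub>E i\<in>I. {-R..R}) x)"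
  proof (rule AE_I2)
    fix x :: "'i \<Rightarrow> real" assume x: "x \<in> space (\<Pi>\<^sub>M i\<in>I. lborel)"
    have "\<bar>u x\<bar> \<le> \<bar>c\<bar>" using pos[of x] bd[of x] by auto
    moreover have "u x = 0" if "x \<notin> (\<Pi>\<^sub>E i\<in>I. {-R..R})"
      using supp[of x] that x by (auto simp: space_PiM PiE_iff)
    ultimately show "norm (u x) \<le> norm (c * indicator (\<Pi>\<^sub>E i\<in>I. {-R..R}) x)"
      by (auto split: split_indicator)
  qed
qed (use m in simp)

text \<open>Integrating out one coordinate preserves the hypothesis: the one-dimensional inequality
  on each pair of fibres is exactly the pointwise assumption for the partial integrals. Their upper
  bound grows to \<open>\<bar>c\<bar> * (2 * R)\<close>, so \<open>c\<close> must vary in the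
  induction. Extensional points are those of the product space, on which the fibres of a measurable
  function are measurable.\<close>

lemma prekopa_leindler_PiM:
  fixes u v w :: "('i \<Rightarrow> real) \<Rightarrow> real"
  assumes "finite I"
    and "u \<in> borel_measurable (\<Pi>\<^sub>M i\<in>I. lborel)" "v \<in> borel_measurable (\<Pi>\<^sub>M i\<in>I. lborel)" "w \<in> borel_measurable (\<Pi>\<^sub>M i\<in>I. lborel)"
    and "\<And>x. 0 \<le> u x" "\<And>x. 0 \<le> v x" "\<And>x. 0 \<le> w x"
    and "\<And>x. u x \<le> c" "\<And>x. v x \<le> c" "\<And>x. w x \<le> c"
    and "\<And>x. \<exists>i\<in>I. x i \<notin> {-R..R} \<Longrightarrow> u x = 0" "\<And>x. \<exists>i\<in>I. x i \<notin> {-R..R} \<Longrightarrow> v x = 0"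
       "\<And>x. \<exists>i\<in>I. x i \<notin> {-R..R} \<Longrightarrow> w x = 0"
    and ts: "t > 0" "s > 0" "t + s = 1" and R: "R \<ge> 0"
    and "\<And>x y. x \<in> extensional I \<Longrightarrow> y \<in> extensional I \<Longrightarrow>
       u x powr t * v y powr s \<le> w (\<lambda>i\<in>I. t * x i + s * y i)"
  shows "(\<integral>x. u x \<partial>(\<Pi>\<^sub>M i\<in>I. lborel)) powr t * (\<integral>x. v x \<partial>(\<Pi>\<^sub>M i\<in>I. lborel)) powr s
     \<le> (\<integral>x. w x \<partial>(\<Pi>\<^sub>M i\<in>I. lborel))"
  using assms(1-13) assms(18)
proof (induction I arbitrary: u v w c rule: finite_induct)
  case empty
  interpret product_sigma_finite "\<lambda>i::'i. lborel :: real measure" by standard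
  have "(\<integral>x. f x \<partial>(\<Pi>\<^sub>M i\<in>{}. lborel)) = f (\<lambda>_. undefined)" for f :: "('i \<Rightarrow> real) \<Rightarrow> real"
    by (simp add: PiM_empty lebesgue_integral_count_space_finite)
  moreover have "(\<lambda>i\<in>{}. t * undefined + s * undefined) = (\<lambda>_::'i. undefined::real)" by (auto simp: restrict_def)
  ultimately show ?case using empty.prems(13)[of "\<lambda>_. undefined" "\<lambda>_. undefined"] by simp
next
  case (insert i I)
  interpret product_sigma_finite "\<lambda>i::'i. lborel :: real measure" by standard
  note m[measurable] = insert.prems(1-3)
  have mi: "f \<in> borel_measurable (\<Pi>\<^sub>M i\<in>insert i I. lborel) \<Longrightarrow> (\<lambda>p. f ((fst p)(i := snd p))) \<in> borel_measurable ((\<Pi>\<^sub>M i\<in>I. lborel) \<Otimes>\<^sub>M lborel)"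
    for f :: "('i \<Rightarrow> real) \<Rightarrow> real"
    using measurable_compose[OF measurable_add_dim[of i I "\<lambda>_. lborel"]] by (auto simp: case_prod_beta')
  have m1: "f \<in> borel_measurable (\<Pi>\<^sub>M i\<in>insert i I. lborel) \<Longrightarrow> x \<in> space (\<Pi>\<^sub>M i\<in>I. lborel) \<Longrightarrow> (\<lambda>a. f (x(i := a))) \<in> borel_measurable borel"
    for f :: "('i \<Rightarrow> real) \<Rightarrow> real" and x
    using measurable_compose[OF measurable_Pair1' mi] by (auto simp: space_PiM)
  have m2: "f \<in> borel_measurable (\<Pi>\<^sub>M i\<in>insert i I. lborel) \<Longrightarrow> (\<lambda>x. \<integral>a. f (x(i := a)) \<partial>lborel) \<in> borel_measurable (\<Pi>\<^sub>M i\<in>I. lborel)"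
    for f :: "('i \<Rightarrow> real) \<Rightarrow> real"
    using lborel.borel_measurable_lebesgue_integral[of "\<lambda>x a. f (x(i := a))" "\<Pi>\<^sub>M i\<in>I. lborel"] mi[of f] by (simp add: case_prod_beta')
  have b2: "(\<integral>a. f (x(i := a)) \<partial>lborel) \<le> \<bar>c\<bar> * (2 * R)"
    if "\<And>x. 0 \<le> f x" "\<And>x. f x \<le> c" "\<And>x. \<exists>i\<in>insert i I. x i \<notin> {-R..R} \<Longrightarrow> f x = 0" for f :: "('i \<Rightarrow> real) \<Rightarrow> real" and x
  proof -
    have "(\<integral>a. f (x(i := a)) \<partial>lborel) \<le> (\<integral>a. \<bar>c\<bar> * indicator {-R..R} a \<partial>lborel)"
    proof (rule integral_mono_AE')
      show "integrable lborel (\<lambda>a. \<bar>c\<bar> * indicator {-R..R} a)"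
        by (intro integrable_mult_right integrable_real_indicator) (auto simp: emeasure_lborel_Icc_eq)
      show "AE a in lborel. f (x(i := a)) \<le> \<bar>c\<bar> * indicator {-R..R} a"
      proof (rule AE_I2)
        fix a :: real
        have "a \<notin> {-R..R} \<Longrightarrow> f (x(i := a)) = 0" by (rule that(3)) auto
        then show "f (x(i := a)) \<le> \<bar>c\<bar> * indicator {-R..R} a" using that(2)[of "x(i := a)"]
          by (auto split: split_indicator)
      qed
    qed (use that in auto)
    then show ?thesis using R by simp
  qed
  have s2: "(\<integral>a. f (x(i := a)) \<partial>lborel) = 0"
    if "\<And>x. \<exists>i\<in>insert i I. x i \<notin> {-R..R} \<Longrightarrow> f x = 0" "\<exists>i\<in>I. x i \<notin> {-R..R}" for f :: "('i \<Rightarrow> real) \<Rightarrow> real" and x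
  proof -
    have "f (x(i := a)) = 0" for a
      by (rule that(1)) (use that(2) insert.hyps in \<open>auto simp del: atLeastAtMost_iff\<close>)
    then show ?thesis by simp
  qed
  have pl: "(\<integral>a. u (x(i := a)) \<partial>lborel) powr t * (\<integral>a. v (y(i := a)) \<partial>lborel) powr s
      \<le> (\<integral>a. w ((\<lambda>j\<in>I. t * x j + s * y j)(i := a)) \<partial>lborel)"
    if xy: "x \<in> extensional I" "y \<in> extensional I" for x y
  proof (rule prekopa_leindler_real[where R = R and c = c])
    show "(\<lambda>a. u (x(i := a))) \<in> borel_measurable borel" "(\<lambda>a. v (y(i := a))) \<in> borel_measurable borel"
         "(\<lambda>a. w ((\<lambda>j\<in>I. t * x j + s * y j)(i := a))) \<in> borel_measurable borel"
      by (auto intro!: m1 m simp: space_PiM PiE_def xy)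
    fix a b :: real
    have e: "(\<lambda>j\<in>I. t * x j + s * y j)(i := t * a + s * b) = (\<lambda>j\<in>insert i I. t * (x(i := a)) j + s * (y(i := b)) j)"
      using insert.hyps by (auto simp: fun_eq_iff restrict_def)
    show "u (x(i := a)) powr t * v (y(i := b)) powr s \<le> w ((\<lambda>j\<in>I. t * x j + s * y j)(i := t * a + s * b))"
      unfolding e by (rule insert.prems(13)) (use xy in \<open>auto simp: extensional_def\<close>)
    show "a \<notin> {-R..R} \<Longrightarrow> u (x(i := a)) = 0" "a \<notin> {-R..R} \<Longrightarrow> v (y(i := a)) = 0"
      "a \<notin> {-R..R} \<Longrightarrow> w ((\<lambda>j\<in>I. t * x j + s * y j)(i := a)) = 0"
      by (intro insert.prems(10-12); auto)+
  qed (use insert.prems ts in auto)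
  have "(\<integral>x. (\<integral>a. u (x(i := a)) \<partial>lborel) \<partial>(\<Pi>\<^sub>M i\<in>I. lborel)) powr t * (\<integral>x. (\<integral>a. v (x(i := a)) \<partial>lborel) \<partial>(\<Pi>\<^sub>M i\<in>I. lborel)) powr s
     \<le> (\<integral>x. (\<integral>a. w (x(i := a)) \<partial>lborel) \<partial>(\<Pi>\<^sub>M i\<in>I. lborel))"
    by (rule insert.IH[where c = "\<bar>c\<bar> * (2 * R)"])
      (assumption | rule pl m2 m b2 s2 insert.prems Bochner_Integration.integral_nonneg)+
  moreover have "integral\<^sup>L (\<Pi>\<^sub>M i\<in>insert i I. lborel) f = (\<integral>x. (\<integral>a. f (x(i := a)) \<partial>lborel) \<partial>(\<Pi>\<^sub>M i\<in>I. lborel))"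
    if "f \<in> borel_measurable (\<Pi>\<^sub>M i\<in>insert i I. lborel)" "\<And>x. 0 \<le> f x" "\<And>x. f x \<le> c" "\<And>x. \<exists>i\<in>insert i I. x i \<notin> {-R..R} \<Longrightarrow> f x = 0"
    for f :: "('i \<Rightarrow> real) \<Rightarrow> real"
    by (intro product_integral_insert insert.hyps integrable_PiM_bounded_support[where c = c and R = R])
      (use that insert.hyps in \<open>auto simp del: atLeastAtMost_iff\<close>)
  ultimately show ?case using insert.prems by simp
qed

lemma prekopa_leindler_bounded:
  fixes u v w :: "'a::euclidean_space \<Rightarrow> real"
  assumes m[measurable]: "u \<in> borel_measurable borel" "v \<in> borel_measurable borel" "w \<in> borel_measurable borel"
    and pos: "\<And>x. 0 \<le> u x" "\<And>x. 0 \<le> v x" "\<And>x. 0 \<le> w x"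
    and bd: "\<And>x. u x \<le> c" "\<And>x. v x \<le> c" "\<And>x. w x \<le> c"
    and supp: "\<And>x. \<exists>b\<in>Basis. x \<bullet> b \<notin> {-R..R} \<Longrightarrow> u x = 0" "\<And>x. \<exists>b\<in>Basis. x \<bullet> b \<notin> {-R..R} \<Longrightarrow> v x = 0"
       "\<And>x. \<exists>b\<in>Basis. x \<bullet> b \<notin> {-R..R} \<Longrightarrow> w x = 0"
    and ts: "t > 0" "s > 0" "t + s = 1" and R: "R \<ge> 0"
    and H: "\<And>x y. u x powr t * v y powr s \<le> w (t *\<^sub>R x + s *\<^sub>R y)"
  shows "(\<integral>x. u x \<partial>lborel) powr t * (\<integral>x. v x \<partial>lborel) powr s \<le> (\<integral>x. w x \<partial>lborel)"
proof -
  define T :: "('a \<Rightarrow> real) \<Rightarrow> 'a" where "T = (\<lambda>f. \<Sum>b\<in>Basis. f b *\<^sub>R b)"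
  have T[measurable]: "T \<in> (\<Pi>\<^sub>M b\<in>Basis. lborel) \<rightarrow>\<^sub>M borel"
    unfolding T_def by measurable
  have Tb: "T x \<bullet> b = x b" if "b \<in> Basis" for x b
    unfolding T_def using that by (simp add: inner_sum_left inner_Basis if_distrib cong: if_cong)
  have int: "(\<integral>x. f x \<partial>lborel) = (\<integral>x. f (T x) \<partial>(\<Pi>\<^sub>M b\<in>Basis. lborel))" if "f \<in> borel_measurable borel" for f :: "'a \<Rightarrow> real"
    by (subst lborel_eq, subst integral_distr) (use that T in \<open>auto simp: T_def\<close>)
  have lin: "T (\<lambda>i\<in>Basis. t * x i + s * y i) = t *\<^sub>R T x + s *\<^sub>R T y" for x y
    by (rule euclidean_eqI) (simp add: Tb inner_add_left)
  show ?thesis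
    unfolding int[OF m(1)] int[OF m(2)] int[OF m(3)]
    by (rule prekopa_leindler_PiM[where R = R and c = c])
      (use pos bd ts R H in \<open>auto simp: lin simp del: atLeastAtMost_iff intro!: supp simp: Tb\<close>)
qed

text \<open>Truncating the height and the support of all three functions alike preserves the hypothesis.\<close>

theorem prekopa_leindler:
  fixes u v w :: "'a::euclidean_space \<Rightarrow> real"
  assumes int: "integrable lborel u" "integrable lborel v" "integrable lborel w"
    and pos: "\<And>x. 0 \<le> u x" "\<And>x. 0 \<le> v x" "\<And>x. 0 \<le> w x"
    and ts: "t > 0" "s > 0" "t + s = 1"
    and H: "\<And>x y. u x powr t * v y powr s \<le> w (t *\<^sub>R x + s *\<^sub>R y)"
  shows "(\<integral>x. u x \<partial>lborel) powr t * (\<integral>x. v x \<partial>lborel) powr s \<le> (\<integral>x. w x \<partial>lborel)"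
proof -
  define B :: "nat \<Rightarrow> 'a set" where "B = (\<lambda>n. cbox (- (real n *\<^sub>R One)) (real n *\<^sub>R One))"
  define F :: "('a \<Rightarrow> real) \<Rightarrow> nat \<Rightarrow> 'a \<Rightarrow> real" where "F = (\<lambda>f n x. min (f x) (real n) * indicator (B n) x)"
  have mem: "x \<in> B n \<longleftrightarrow> (\<forall>b\<in>Basis. x \<bullet> b \<in> {- real n..real n})" for x n
    unfolding B_def mem_box by simp
  have lim: "(\<lambda>n. \<integral>x. F f n x \<partial>lborel) \<longlonglongrightarrow> (\<integral>x. f x \<partial>lborel)"
    if f: "integrable lborel f" "\<And>x. 0 \<le> f x" for f
  proof (rule integral_dominated_convergence[where w = f])
    show "AE x in lborel. (\<lambda>n. F f n x) \<longlonglongrightarrow> f x"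
    proof (rule AE_I2)
      fix x :: 'a
      obtain N where N: "max (norm x) (f x) \<le> real N" using real_arch_simple by blast
      have "F f n x = f x" if "n \<ge> N" for n
      proof -
        have nn: "norm x \<le> real n" "f x \<le> real n" using N that by linarith+
        have "\<bar>x \<bullet> b\<bar> \<le> real n" if "b \<in> Basis" for b
          using Basis_le_norm[OF that, of x] nn by linarith
        then have "x \<in> B n" unfolding mem by (simp add: abs_le_iff) (metis minus_le_iff)
        then show ?thesis using nn by (simp add: F_def)
      qed
      then show "(\<lambda>n. F f n x) \<longlonglongrightarrow> f x"
        by (intro tendsto_eventually eventually_sequentiallyI)
    qed
    show "AE x in lborel. norm (F f n x) \<le> f x" for n
      using f by (intro AE_I2) (auto simp: F_def split: split_indicator)
  qed (use f in \<open>auto simp: F_def B_def borel_measurable_integrable\<close>)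
  have nn: "0 \<le> F f n x" if "\<And>x. 0 \<le> f x" for f n x
    using that by (auto simp: F_def)
  have "(\<integral>x. F u n x \<partial>lborel) powr t * (\<integral>x. F v n x \<partial>lborel) powr s \<le> (\<integral>x. F w n x \<partial>lborel)" for n
  proof (rule prekopa_leindler_bounded[where c = "real n" and R = "real n"])
    have "F f n \<in> borel_measurable borel" if "integrable lborel f" for f
      using that by (auto simp: F_def B_def borel_measurable_integrable)
    then show "F u n \<in> borel_measurable borel" "F v n \<in> borel_measurable borel" "F w n \<in> borel_measurable borel"
      using int by auto
    fix x y :: 'a
    show "F u n x powr t * F v n y powr s \<le> F w n (t *\<^sub>R x + s *\<^sub>R y)"
    proof (cases "x \<in> B n \<and> y \<in> B n")
      case True
      then have "t *\<^sub>R x + s *\<^sub>R y \<in> B n"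
        using ts unfolding B_def by (intro convexD[OF convex_box(1)]) auto
      moreover have "min (u x) (real n) powr t * min (v y) (real n) powr s \<le> u x powr t * v y powr s"
        using pos ts by (intro mult_mono powr_mono2) auto
      moreover have "min (u x) (real n) powr t * min (v y) (real n) powr s \<le> real n powr t * real n powr s"
        using pos ts by (intro mult_mono powr_mono2) auto
      moreover have "real n powr t * real n powr s = real n" using ts by (simp add: powr_add[symmetric])
      ultimately show ?thesis using True H[of x y] by (simp add: F_def)
    next
      case False
      then show ?thesis using nn[OF pos(3)] by (auto simp: F_def)
    qed
  qed (use pos ts in \<open>auto simp: nn mem simp del: atLeastAtMost_iff\<close>, auto simp: F_def mem split: split_indicator)
  moreover have "(\<lambda>n. (\<integral>x. F u n x \<partial>lborel) powr t * (\<integral>x. F v n x \<partial>lborel) powr s)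
     \<longlonglongrightarrow> (\<integral>x. u x \<partial>lborel) powr t * (\<integral>x. v x \<partial>lborel) powr s"
    using ts by (intro tendsto_mult tendsto_powr' lim int pos tendsto_const) (auto simp: nn pos)
  ultimately show ?thesis
    using lim[OF int(3) pos(3)] by (intro LIMSEQ_le) auto
qed

subsection \<open>Defective convexity\<close>

lemma GDERIV_line:
  fixes f :: "'a::real_inner \<Rightarrow> real"
  assumes "GDERIV f (x + a *\<^sub>R h) :> D"
  shows "((\<lambda>a. f (x + a *\<^sub>R h)) has_real_derivative (D \<bullet> h)) (at a)"
proof -
  have "((\<lambda>a. x + a *\<^sub>R h) has_derivative (\<lambda>d. d *\<^sub>R h)) (at a)"
    by (auto intro!: derivative_eq_intros)
  moreover have "(f has_derivative (\<lambda>h. h \<bullet> D)) (at (x + a *\<^sub>R h))"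
    using assms by (simp add: gderiv_def)
  ultimately have "((\<lambda>a. f (x + a *\<^sub>R h)) has_derivative (\<lambda>d. (d *\<^sub>R h) \<bullet> D)) (at a)"
    by (rule has_derivative_compose)
  then show ?thesis
    by (simp add: has_field_derivative_def inner_commute mult_commute_abs)
qed

lemma GDERIV_imp_continuous_on:
  assumes "\<And>x. GDERIV f x :> gf x"
  shows "continuous_on UNIV f"
  using assms unfolding gderiv_def
  by (auto intro!: continuous_at_imp_continuous_on has_derivative_continuous)

text \<open>\<open>P a\<close> compares the pair \<open>z + a s h\<close>, \<open>z - a t h\<close>
  with the claimed lower bound for its gap. The claim is \<open>P 0 \<le> P 1\<close>, so it is
  enough to bound the derivative of \<open>P\<close> below by 0.\<close>

lemma convexity_defect_sqrt:
  fixes U :: "'a::real_inner \<Rightarrow> real" and gU :: "'a \<Rightarrow> 'a"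
  assumes grad: "\<And>x. GDERIV U x :> gU x"
    and mono: "\<And>x y. (gU x - gU y) \<bullet> (x - y) \<ge> 0"
    and conv: "\<And>x y. (gU x - gU y) \<bullet> (x - y) \<ge> \<kappa> * ((norm (x - y))\<^sup>2 - \<epsilon>)"
    and k: "\<kappa> \<ge> 0" and e: "\<epsilon> > 0" and ts: "t > 0" "s > 0" "t + s = 1"
  shows "t * U (z + s *\<^sub>R h) + s * U (z - t *\<^sub>R h) - U z
     \<ge> t * s * (\<kappa> * (norm h)\<^sup>2 / 2 - \<kappa> * sqrt \<epsilon> * norm h)"
proof -
  define r where "r = norm h"
  define P where "P = (\<lambda>a. t * U (z + a *\<^sub>R (s *\<^sub>R h)) + s * U (z + a *\<^sub>R (- t *\<^sub>R h))
     - t * s * \<kappa> * (a\<^sup>2 * r\<^sup>2 / 2 - sqrt \<epsilon> * r * a))"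
  have "\<exists>y. DERIV P a :> y \<and> y \<ge> 0" if a: "0 < a" "a < 1" for a
  proof -
    define p q where "p = z + a *\<^sub>R (s *\<^sub>R h)" and "q = z + a *\<^sub>R (- t *\<^sub>R h)"
    have d: "DERIV P a :> t * (gU p \<bullet> (s *\<^sub>R h)) + s * (gU q \<bullet> (- t *\<^sub>R h)) - t * s * \<kappa> * (a * r\<^sup>2 - sqrt \<epsilon> * r)"
      unfolding P_def p_def q_def
      by (rule derivative_eq_intros GDERIV_line grad refl | simp)+
    have pq: "p - q = a *\<^sub>R h"
      using ts(3) unfolding p_def q_def
      by (simp add: algebra_simps) (metis mult.commute ring_class.ring_distribs(1) mult_1_right scaleR_left.add)
    define G where "G = (gU p - gU q) \<bullet> h"
    have G1: "a * G \<ge> 0" and G2: "a * G \<ge> \<kappa> * ((a * r)\<^sup>2 - \<epsilon>)"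
      using mono[of p q] conv[of p q] a unfolding pq G_def r_def by (auto simp: power_mult_distrib)
    \<comment> \<open>Dividing \<open>G2\<close> by \<open>a\<close> would leave
      \<open>\<epsilon> / a\<close>, which is not integrable at 0. Where
      \<open>a r <= sqrt \<epsilon>\<close> the claimed bound is nonpositive and monotonicity
      suffices; beyond that,
      \<open>(a r)^2 - \<epsilon> >= a r (a r - sqrt \<epsilon>)\<close>.\<close>
    have "G \<ge> \<kappa> * (r * (a * r - sqrt \<epsilon>))"
    proof (cases "a * r \<le> sqrt \<epsilon>")
      case True
      then have "\<kappa> * (r * (a * r - sqrt \<epsilon>)) \<le> 0"
        using k by (intro mult_nonneg_nonpos) (auto simp: r_def)
      also have "0 \<le> G" using G1 a by (simp add: zero_le_mult_iff)
      finally show ?thesis .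
    next
      case False
      have "\<epsilon> = sqrt \<epsilon> * sqrt \<epsilon>" using e by simp
      also have "\<dots> \<le> a * r * sqrt \<epsilon>" using False e by (intro mult_right_mono) auto
      finally have "a * r * (a * r - sqrt \<epsilon>) \<le> (a * r)\<^sup>2 - \<epsilon>" by (simp add: algebra_simps power2_eq_square)
      then have "\<kappa> * (a * r * (a * r - sqrt \<epsilon>)) \<le> \<kappa> * ((a * r)\<^sup>2 - \<epsilon>)" using k by (rule mult_left_mono)
      also have "\<dots> \<le> a * G" by (rule G2)
      finally have "a * (\<kappa> * (r * (a * r - sqrt \<epsilon>))) \<le> a * G" by (simp add: algebra_simps)
      then show ?thesis using a by simp
    qed
    then have "t * s * (G - \<kappa> * (r * (a * r - sqrt \<epsilon>))) \<ge> 0" using ts by simp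
    also have "t * s * (G - \<kappa> * (r * (a * r - sqrt \<epsilon>)))
       = t * (gU p \<bullet> (s *\<^sub>R h)) + s * (gU q \<bullet> (- t *\<^sub>R h)) - t * s * \<kappa> * (a * r\<^sup>2 - sqrt \<epsilon> * r)"
      unfolding G_def by (simp add: algebra_simps power2_eq_square inner_diff_left)
    finally show ?thesis using d by blast
  qed
  moreover have "continuous_on {0..1} P"
    unfolding P_def
    by (intro continuous_intros continuous_on_compose2[OF GDERIV_imp_continuous_on[OF grad]]) auto
  ultimately have "P 0 \<le> P 1"
    by (intro DERIV_nonneg_imp_increasing_open[of 0 1 P]) auto
  moreover have "U z = t * U z + s * U z" using ts(3) by (metis distrib_right mult_1)
  ultimately show ?thesis unfolding P_def r_def by (simp add: algebra_simps)
qed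

text \<open>The square \<open>\<kappa> (|h| - 10 sqrt \<epsilon>)^2\<close> being nonnegative trades
  the linear term for a tenth of the quadratic one and the constant
  \<open>5 \<kappa> \<epsilon>\<close>. A larger share of the quadratic term would cost a larger
  constant.\<close>

lemma convexity_defect:
  fixes U :: "'a::real_inner \<Rightarrow> real" and gU :: "'a \<Rightarrow> 'a"
  assumes grad: "\<And>x. GDERIV U x :> gU x"
    and mono: "\<And>x y. (gU x - gU y) \<bullet> (x - y) \<ge> 0"
    and conv: "\<And>x y. (gU x - gU y) \<bullet> (x - y) \<ge> \<kappa> * ((norm (x - y))\<^sup>2 - \<epsilon>)"
    and k: "\<kappa> \<ge> 0" and e: "\<epsilon> > 0" and ts: "t > 0" "s > 0" "t + s = 1"
  shows "t * U (z + s *\<^sub>R h) + s * U (z - t *\<^sub>R h) - U z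
     \<ge> t * s * (9/10 * \<kappa> * (norm h)\<^sup>2 / 2 - 5 * \<kappa> * \<epsilon>)"
proof -
  have "0 \<le> \<kappa> * (norm h - 10 * sqrt \<epsilon>)\<^sup>2" using k by simp
  also have "\<kappa> * (norm h - 10 * sqrt \<epsilon>)\<^sup>2 = 20 * ((\<kappa> * (norm h)\<^sup>2 / 2 - \<kappa> * sqrt \<epsilon> * norm h) - (9/10 * \<kappa> * (norm h)\<^sup>2 / 2 - 5 * \<kappa> * \<epsilon>))"
    using e by (simp add: power2_eq_square algebra_simps)
  finally have "9/10 * \<kappa> * (norm h)\<^sup>2 / 2 - 5 * \<kappa> * \<epsilon> \<le> \<kappa> * (norm h)\<^sup>2 / 2 - \<kappa> * sqrt \<epsilon> * norm h" by simp
  then have "t * s * (9/10 * \<kappa> * (norm h)\<^sup>2 / 2 - 5 * \<kappa> * \<epsilon>) \<le> t * s * (\<kappa> * (norm h)\<^sup>2 / 2 - \<kappa> * sqrt \<epsilon> * norm h)"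
    using ts by (intro mult_left_mono) auto
  also note convexity_defect_sqrt[OF grad mono conv k e ts, where z = z and h = h]
  finally show ?thesis .
qed

section \<open>The Gibbs measure of a potential with a convexity defect\<close>

text \<open>Integrated form of the gradient hypothesis, for the pair \<open>x = z + s h\<close>,
  \<open>y = z - t h\<close> with barycentre \<open>z\<close>. The factor \<open>t * s\<close> in
  front of \<open>D\<close> makes the defect vanish to first order in \<open>s\<close>.\<close>

locale defect_convex =
  fixes U :: "real^'n::finite \<Rightarrow> real" and \<rho> D :: real
  assumes cont: "continuous_on UNIV U"
    and int: "integrable lborel (\<lambda>x. exp (- U x))"
    and rho: "\<rho> > 0" and D: "D \<ge> 0"
    and defect: "\<And>t s z h. t > 0 \<Longrightarrow> s > 0 \<Longrightarrow> t + s = 1 \<Longrightarrow>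
      t * U (z + s *\<^sub>R h) + s * U (z - t *\<^sub>R h) - U z \<ge> t * s * (\<rho> * (norm h)\<^sup>2 / 2 - D)"
begin

abbreviation "\<mu> \<equiv> gibbs U"
abbreviation "Z \<equiv> (\<integral>x. exp (- U x) \<partial>lborel)"

lemma sets_gibbs [simp, measurable_cong]: "sets \<mu> = sets borel"
  by (simp add: gibbs_def)

lemma space_gibbs [simp]: "space \<mu> = UNIV"
  by (simp add: gibbs_def)

lemma U_measurable [measurable]: "U \<in> borel_measurable borel"
  using cont by (rule borel_measurable_continuous_onI)

lemma Z_pos: "Z > 0"
proof -
  have "Z \<noteq> 0"
  proof
    assume "Z = 0"
    then have "AE x in lborel. exp (- U x) = 0"
      using integral_nonneg_eq_0_iff_AE[OF int] by simp
    then have "AE x in (lborel :: (real^'n) measure). False" by simp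
    then have "emeasure lborel (UNIV :: (real^'n) set) = 0"
      by (simp add: AE_iff_measurable[of UNIV])
    then show False by simp
  qed
  moreover have "Z \<ge> 0" by simp
  ultimately show ?thesis by linarith
qed

lemma integrable_gibbs_iff:
  fixes f :: "real^'n \<Rightarrow> real"
  assumes [measurable]: "f \<in> borel_measurable borel"
  shows "integrable \<mu> f \<longleftrightarrow> integrable lborel (\<lambda>x. exp (- U x) * f x)"
proof -
  have "integrable \<mu> f \<longleftrightarrow> integrable lborel (\<lambda>x. (exp (- U x) / Z) *\<^sub>R f x)"
    unfolding gibbs_def using Z_pos by (subst integrable_density) auto
  also have "(\<lambda>x. (exp (- U x) / Z) *\<^sub>R f x) = (\<lambda>x. (1 / Z) * (exp (- U x) * f x))" by auto
  finally show ?thesis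
    using Z_pos integrable_mult_left_iff[of lborel "1 / Z" "\<lambda>x. exp (- U x) * f x"] by simp
qed

lemma integral_gibbs:
  fixes f :: "real^'n \<Rightarrow> real"
  assumes [measurable]: "f \<in> borel_measurable borel"
  shows "(\<integral>x. f x \<partial>\<mu>) = (\<integral>x. exp (- U x) * f x \<partial>lborel) / Z"
proof -
  have "(\<integral>x. f x \<partial>\<mu>) = (\<integral>x. (exp (- U x) / Z) *\<^sub>R f x \<partial>lborel)"
    unfolding gibbs_def using Z_pos by (subst integral_density) auto
  also have "\<dots> = (\<integral>x. (1 / Z) * (exp (- U x) * f x) \<partial>lborel)"
    by (intro Bochner_Integration.integral_cong) auto
  finally show ?thesis by simp
qed

sublocale prob_space \<mu>
proof
  have "emeasure \<mu> (space \<mu>) = (\<integral>\<^sup>+x. ennreal (exp (- U x) / Z) \<partial>lborel)"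
    unfolding gibbs_def by (subst emeasure_density) auto
  also have "\<dots> = ennreal (\<integral>x. exp (- U x) / Z \<partial>lborel)"
    using int Z_pos by (intro nn_integral_eq_integral) auto
  also have "\<dots> = 1" using Z_pos by simp
  finally show "emeasure \<mu> (space \<mu>) = 1" .
qed

lemma prob_UNIV [simp]: "prob UNIV = 1"
  using prob_space by simp

lemma integrable_bounded:
  fixes f :: "real^'n \<Rightarrow> real"
  assumes "f \<in> borel_measurable borel" "\<And>x. \<bar>f x\<bar> \<le> c"
  shows "integrable \<mu> f"
  by (rule integrable_const_bound[of _ c]) (use assms in \<open>auto simp: measurable_cong_sets[OF sets_gibbs refl]\<close>)

section \<open>Entropy bound by linearising Prekopa-Leindler\<close>

text \<open>Prekopa-Leindler for the triple \<open>e^(-U) e^(p/t)\<close>, \<open>e^(-U)\<close>,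
  \<open>e^(-U) e^q\<close>: the convexity gap of \<open>U\<close> pays for the quadratic term
  allowed in \<open>H\<close>. The unperturbed second function contributes \<open>Z powr s\<close>,
  and \<open>Z powr t * Z powr s = Z\<close> normalises both sides.\<close>

lemma prekopa_leindler_gibbs:
  assumes [measurable]: "p \<in> borel_measurable borel" "q \<in> borel_measurable borel"
    and bd: "\<And>x. p x \<le> c" "\<And>x. q x \<le> c"
    and ts: "t > 0" "s > 0" "t + s = 1"
    and H: "\<And>z h. p (z + s *\<^sub>R h) \<le> q z + t * s * (\<rho> * (norm h)\<^sup>2 / 2 - D)"
  shows "(\<integral>x. exp (p x / t) \<partial>\<mu>) powr t \<le> (\<integral>x. exp (q x) \<partial>\<mu>)"
proof -
  have i1: "integrable lborel (\<lambda>x. exp (- U x) * exp (p x / t))"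
    by (subst integrable_gibbs_iff[symmetric], simp,
        rule integrable_bounded[of _ "exp (c / t)"]) (use bd ts in \<open>auto simp: divide_right_mono\<close>)
  have i2: "integrable lborel (\<lambda>x. exp (- U x) * exp (q x))"
    by (subst integrable_gibbs_iff[symmetric], simp,
        rule integrable_bounded[of _ "exp c"]) (use bd ts in \<open>auto simp: divide_right_mono\<close>)
  have "(\<integral>x. exp (- U x) * exp (p x / t) \<partial>lborel) powr t * Z powr s \<le> (\<integral>x. exp (- U x) * exp (q x) \<partial>lborel)"
  proof (rule prekopa_leindler[OF i1 int i2 _ _ _ ts])
    fix x y :: "real^'n"
    define z h where "z = t *\<^sub>R x + s *\<^sub>R y" and "h = x - y"
    have "z + s *\<^sub>R h = (t + s) *\<^sub>R x" "z - t *\<^sub>R h = (t + s) *\<^sub>R y"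
      unfolding z_def h_def by (simp_all add: algebra_simps)
    then have xy: "z + s *\<^sub>R h = x" "z - t *\<^sub>R h = y" using ts by auto
    have "p x - t * U x - s * U y \<le> q z - U z"
      using H[of z h] defect[OF ts, where z = z and h = h] unfolding xy by linarith
    moreover have "(exp (- U x) * exp (p x / t)) powr t * exp (- U y) powr s = exp (p x - t * U x - s * U y)"
      using ts by (simp add: powr_def exp_add[symmetric] algebra_simps)
    ultimately show "(exp (- U x) * exp (p x / t)) powr t * exp (- U y) powr s \<le> exp (- U (t *\<^sub>R x + s *\<^sub>R y)) * exp (q (t *\<^sub>R x + s *\<^sub>R y))"
      unfolding z_def[symmetric] by (simp add: exp_add[symmetric] algebra_simps)
  qed auto
  then have "(\<integral>x. exp (- U x) * exp (p x / t) \<partial>lborel) powr t * Z powr s / Z \<le> (\<integral>x. exp (- U x) * exp (q x) \<partial>lborel) / Z"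
    using Z_pos by (intro divide_right_mono) auto
  moreover have "Z = Z powr t * Z powr s" using ts Z_pos by (simp add: powr_add[symmetric])
  moreover have "(\<integral>x. exp (- U x) * exp (p x / t) \<partial>lborel) powr t * Z powr s / (Z powr t * Z powr s)
      = ((\<integral>x. exp (- U x) * exp (p x / t) \<partial>lborel) / Z) powr t"
    using Z_pos by (subst powr_divide) (auto intro!: Bochner_Integration.integral_nonneg)
  ultimately show ?thesis by (simp add: integral_gibbs)
qed

text \<open>First-order expansion of the sup-convolution of \<open>g\<close> with a quadratic cost,
  that is, one short step of a Hamilton-Jacobi flow, uniform in \<open>z\<close> and
  \<open>h\<close>. The mean value theorem and Young's inequality produce
  \<open>|gg z|^2 / (2 \<rho>)\<close>, and the summand \<open>D\<close> compensates the defect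
  because \<open>t s D <= s D\<close>.\<close>

lemma sup_convolution_bound:
  fixes g :: "real^'n \<Rightarrow> real"
  assumes g: "\<And>x. GDERIV g x :> gg x" and L: "\<And>x. norm (gg x) \<le> L"
    and uc: "uniformly_continuous_on UNIV gg" and eta: "\<eta> > 0"
  obtains s0 where "0 < s0" "s0 \<le> 1/2"
    "\<And>s z h. 0 < s \<Longrightarrow> s < s0 \<Longrightarrow>
       g (z + s *\<^sub>R h) \<le> g z + s * ((norm (gg z))\<^sup>2 / (2 * \<rho>) + D + \<eta>) + (1 - s) * s * (\<rho> * (norm h)\<^sup>2 / 2 - D)"
proof -
  have L0: "L \<ge> 0" using L[of 0] norm_ge_zero order_trans by blast
  \<comment> \<open>For \<open>|h| >= R\<close> the quadratic cost alone dominates, since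
    \<open>L <= t \<rho> |h| / 2\<close> once \<open>t >= 1/2\<close>. For shorter \<open>h\<close>
    the displacement is small enough to use uniform continuity of \<open>gg\<close>.\<close>
  define R where "R = 4 * L / \<rho>"
  have R: "R \<ge> 0" using L0 rho by (simp add: R_def)
  define \<delta> where "\<delta> = \<eta> / 2 / (R + 1)"
  have \<delta>: "\<delta> > 0" using eta R by (simp add: \<delta>_def)
  obtain d where d: "d > 0" "\<And>x y. dist y x < d \<Longrightarrow> dist (gg y) (gg x) < \<delta>"
    using uc \<delta> unfolding uniformly_continuous_on_def by (metis UNIV_I)
  \<comment> \<open>The three bounds ensure \<open>t >= 1/2\<close>, a displacement below
    \<open>d\<close>, and an error of at most \<open>\<eta> / 2\<close> when
    \<open>1 / (2 t \<rho>)\<close> is replaced by \<open>1 / (2 \<rho>)\<close>. The other half of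
    \<eta> is the oscillation of \<open>gg\<close>.\<close>
  define s0 where "s0 = min (1/2) (min (d / (R + 1)) (\<eta> * \<rho> / (2 * (L\<^sup>2 + 1))))"
  have pos: "L\<^sup>2 + 1 > 0" by (simp add: add_nonneg_pos)
  have s0: "0 < s0" "s0 \<le> 1/2"
    unfolding s0_def by (use d(1) R eta rho pos in simp) (rule min.cobounded1)
  show thesis
  proof (rule that[OF s0])
    fix s :: real and z h :: "real^'n" assume s: "0 < s" "s < s0"
    define t where "t = 1 - s"
    have t: "t \<ge> 1/2" "t \<le> 1" "t + s = 1" using s s0 by (auto simp: t_def)
    have "\<exists>\<xi>>0. \<xi> < s \<and> g (z + s *\<^sub>R h) - g (z + 0 *\<^sub>R h) = (s - 0) * (gg (z + \<xi> *\<^sub>R h) \<bullet> h)"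
      using s by (intro MVT2 GDERIV_line g)
    then obtain \<xi> where xi: "0 < \<xi>" "\<xi> < s" "g (z + s *\<^sub>R h) - g z = s * (gg (z + \<xi> *\<^sub>R h) \<bullet> h)" by auto
    have "gg (z + \<xi> *\<^sub>R h) \<bullet> h \<le> (norm (gg z))\<^sup>2 / (2 * \<rho>) + \<eta> + t * \<rho> * (norm h)\<^sup>2 / 2"
    proof (cases "norm h \<ge> R")
      case True
      then have "4 * L \<le> \<rho> * norm h" using rho by (simp add: R_def field_simps)
      also have "\<rho> * norm h \<le> 2 * t * (\<rho> * norm h)" using t rho mult_right_mono[of 1 "2 * t" "\<rho> * norm h"] by simp
      finally have Lh: "L \<le> t * \<rho> * norm h / 2" by (simp add: mult_ac)
      have "gg (z + \<xi> *\<^sub>R h) \<bullet> h \<le> norm (gg (z + \<xi> *\<^sub>R h)) * norm h" by (rule norm_cauchy_schwarz)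
      also have "\<dots> \<le> (t * \<rho> * norm h / 2) * norm h"
        by (intro mult_right_mono order_trans[OF L Lh]) auto
      also have "\<dots> = t * \<rho> * (norm h)\<^sup>2 / 2" by (simp add: power2_eq_square)
      finally have "gg (z + \<xi> *\<^sub>R h) \<bullet> h \<le> t * \<rho> * (norm h)\<^sup>2 / 2" .
      moreover have "(norm (gg z))\<^sup>2 / (2 * \<rho>) \<ge> 0" using rho by simp
      ultimately show ?thesis using eta by linarith
    next
      case False
      have "s < d / (R + 1)" using s by (simp add: s0_def)
      then have "s * (R + 1) < d" using R by (simp add: field_simps)
      moreover have "\<xi> * norm h \<le> s * (R + 1)" using False xi by (intro mult_mono) auto
      ultimately have "dist (gg (z + \<xi> *\<^sub>R h)) (gg z) < \<delta>"
        using xi by (intro d) (simp add: dist_norm)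
      then have n: "norm (gg (z + \<xi> *\<^sub>R h) - gg z) \<le> \<delta>" by (simp add: dist_norm)
      have "(gg (z + \<xi> *\<^sub>R h) - gg z) \<bullet> h \<le> norm (gg (z + \<xi> *\<^sub>R h) - gg z) * norm h" by (rule norm_cauchy_schwarz)
      also have "\<dots> \<le> \<delta> * (R + 1)" using n False \<delta> by (intro mult_mono) auto
      also have "\<dots> = \<eta> / 2"
        using R by (intro nonzero_eq_divide_eq[THEN iffD1, OF _ \<delta>_def]) simp
      finally have 1: "gg (z + \<xi> *\<^sub>R h) \<bullet> h \<le> gg z \<bullet> h + \<eta> / 2" by (simp add: inner_diff_left)
      define a where "a = norm (gg z)"
      have "0 \<le> (a - t * \<rho> * norm h)\<^sup>2 / (2 * t * \<rho>)" using t rho by simp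
      also have "\<dots> = a\<^sup>2 / (2 * t * \<rho>) - a * norm h + t * \<rho> * (norm h)\<^sup>2 / 2"
        using t rho by (simp add: field_simps power2_eq_square)
      finally have 2: "gg z \<bullet> h \<le> a\<^sup>2 / (2 * t * \<rho>) + t * \<rho> * (norm h)\<^sup>2 / 2"
        using norm_cauchy_schwarz[of "gg z" h] unfolding a_def by linarith
      have "a\<^sup>2 / (2 * t * \<rho>) = a\<^sup>2 / (2 * \<rho>) + a\<^sup>2 * s / (2 * t * \<rho>)"
        using t rho by (simp add: field_simps t_def)
      moreover have "a\<^sup>2 * s / (2 * t * \<rho>) \<le> \<eta> / 2"
      proof -
        have "s < \<eta> * \<rho> / (2 * (L\<^sup>2 + 1))" using s by (simp add: s0_def)
        then have "s * (2 * (L\<^sup>2 + 1)) < \<eta> * \<rho>" using pos by (simp add: pos_less_divide_eq)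
        moreover have "a\<^sup>2 \<le> L\<^sup>2 + 1" using L[of z] power_mono[of a L 2] by (simp add: a_def)
        then have "s * (2 * a\<^sup>2) \<le> s * (2 * (L\<^sup>2 + 1))" using s by (intro mult_left_mono) auto
        ultimately have "2 * (a\<^sup>2 * s) \<le> \<eta> * \<rho>" by (simp add: algebra_simps)
        moreover have "\<eta> * \<rho> \<le> 2 * t * (\<eta> * \<rho>)" using t eta rho by simp
        moreover have "a\<^sup>2 * s \<ge> 0" using s by simp
        ultimately have "a\<^sup>2 * s \<le> t * \<rho> * \<eta>" by (simp add: algebra_simps)
        then show ?thesis using t rho by (simp add: field_simps)
      qed
      ultimately show ?thesis using 1 2 unfolding a_def by linarith
    qed
    then have "s * (gg (z + \<xi> *\<^sub>R h) \<bullet> h) \<le> s * ((norm (gg z))\<^sup>2 / (2 * \<rho>) + \<eta> + t * \<rho> * (norm h)\<^sup>2 / 2)"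
      using s by (intro mult_left_mono) auto
    moreover have "(t * s) * D \<le> s * D" using t s D by (intro mult_right_mono) (auto simp: t_def)
    ultimately have "g (z + s *\<^sub>R h) \<le> g z + s * ((norm (gg z))\<^sup>2 / (2 * \<rho>) + D + \<eta>) + t * s * (\<rho> * (norm h)\<^sup>2 / 2 - D)"
      using xi(3) by (simp add: algebra_simps)
    then show "g (z + s *\<^sub>R h) \<le> g z + s * ((norm (gg z))\<^sup>2 / (2 * \<rho>) + D + \<eta>) + (1 - s) * s * (\<rho> * (norm h)\<^sup>2 / 2 - D)"
      by (simp add: t_def)
  qed
qed

text \<open>Both sides of the Prekopa-Leindler inequality agree at \<open>s = 0\<close>; comparing first-order terms in \<open>s\<close>
  gives the entropy bound.\<close>

lemma entropy_bound_normalized: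
  fixes g :: "real^'n \<Rightarrow> real"
  assumes g: "\<And>x. GDERIV g x :> gg x" and c: "\<And>x. \<bar>g x\<bar> \<le> c" and L: "\<And>x. norm (gg x) \<le> L"
    and uc: "uniformly_continuous_on UNIV gg" and one: "(\<integral>x. exp (g x) \<partial>\<mu>) = 1"
  shows "(\<integral>x. exp (g x) * g x \<partial>\<mu>) \<le> (\<integral>x. exp (g x) * ((norm (gg x))\<^sup>2 / (2 * \<rho>) + D) \<partial>\<mu>)"
proof (rule field_le_epsilon)
  fix \<eta> :: real assume eta: "\<eta> > 0"
  have [measurable]: "g \<in> borel_measurable borel"
    using GDERIV_imp_continuous_on[OF g] by (rule borel_measurable_continuous_onI)
  have [measurable]: "gg \<in> borel_measurable borel"
    using uniformly_continuous_imp_continuous[OF uc] by (rule borel_measurable_continuous_onI)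
  define X where "X = (\<lambda>x. (norm (gg x))\<^sup>2 / (2 * \<rho>) + D + \<eta>)"
  have [measurable]: "X \<in> borel_measurable borel" by (simp add: X_def)
  define B where "B = L\<^sup>2 / (2 * \<rho>) + D + \<eta>"
  have X0: "X x > 0" for x using rho D eta by (simp add: X_def add_nonneg_pos)
  have XB: "X x \<le> B" for x
    unfolding X_def B_def using rho L by (simp add: divide_right_mono power_mono)
  have B: "B > 0" using X0 XB order_less_le_trans by blast
  define E where "E = (\<integral>x. exp (g x) * g x \<partial>\<mu>)"
  define Y where "Y = (\<integral>x. exp (g x) * X x \<partial>\<mu>)"
  have eg: "exp (g x) \<le> exp c" for x using c[of x] by simp
  have ig: "integrable \<mu> (\<lambda>x. exp (g x))"
    by (rule integrable_bounded[of _ "exp c"]) (use eg in auto)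
  have igg: "integrable \<mu> (\<lambda>x. exp (g x) * g x)"
    by (rule integrable_bounded[of _ "exp c * c"]) (auto simp: abs_mult intro!: mult_mono c eg)
  have igX: "integrable \<mu> (\<lambda>x. exp (g x) * X x)"
    by (rule integrable_bounded[of _ "exp c * B"])
       (use X0 in \<open>auto simp: abs_mult less_imp_le intro!: mult_mono XB eg\<close>)
  \<comment> \<open>The entropy is nonnegative because \<open>e^g - 1 <= e^g g\<close> pointwise.
    This makes \<open>y\<close> below nonnegative, as the lower bound for
    \<open>(1 + y) powr t\<close> requires.\<close>
  have E0: "E \<ge> 0"
  proof -
    have "0 = (\<integral>x. exp (g x) - 1 \<partial>\<mu>)" using one ig by simp
    also have "\<dots> \<le> E" unfolding E_def
    proof (rule integral_mono)
      fix x show "exp (g x) - 1 \<le> exp (g x) * g x"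
        using exp_ge_add_one_self[of "- g x"] mult_left_mono[of "1 - g x" "exp (- g x)" "exp (g x)"]
        by (simp add: exp_minus_inverse algebra_simps)
    qed (use ig igg in auto)
    finally show ?thesis .
  qed
  obtain s0 where s0: "0 < s0" "s0 \<le> 1/2"
    "\<And>s z h. 0 < s \<Longrightarrow> s < s0 \<Longrightarrow>
       g (z + s *\<^sub>R h) \<le> g z + s * X z + (1 - s) * s * (\<rho> * (norm h)\<^sup>2 / 2 - D)"
    unfolding X_def using sup_convolution_bound[OF g L uc eta] by metis
  \<comment> \<open>Prekopa-Leindler is used with \<open>p = g\<close> and
    \<open>q = g + s X\<close>. The right side is at most \<open>1 + s Y + (s B)^2\<close>, the left
    side at least \<open>1 + s E - s y^2\<close> with \<open>y\<close> of order \<open>s\<close>;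
    dividing by \<open>s\<close> leaves an error that vanishes with \<open>s\<close>.\<close>
  have key: "E \<le> Y + s * (B\<^sup>2 + 4 * E\<^sup>2)" if s: "0 < s" "s < s0" "s * B \<le> 1" for s
  proof -
    define t where "t = 1 - s"
    have t: "t \<ge> 1/2" "t < 1" "t + s = 1" using s s0 by (auto simp: t_def)
    have sX: "0 \<le> s * X x" "s * X x \<le> s * B" for x
      using s X0[of x] XB by (auto simp: less_imp_le)
    have sXc: "g x + s * X x \<le> c + 1" for x using c[of x] sX[of x] s by linarith
    have "(\<integral>x. exp (g x / t) \<partial>\<mu>) powr t \<le> (\<integral>x. exp (g x + s * X x) \<partial>\<mu>)"
    proof (rule prekopa_leindler_gibbs[where c = "c + 1" and s = s])
      show "g x \<le> c + 1" for x using c[of x] by simp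
      show "g x + s * X x \<le> c + 1" for x by (rule sXc)
    qed (use t s s0(3) in \<open>auto simp: t_def\<close>)
    also have "\<dots> \<le> (\<integral>x. exp (g x) + s * (exp (g x) * X x) + exp (g x) * (s * B)\<^sup>2 \<partial>\<mu>)"
    proof (rule integral_mono)
      show "integrable \<mu> (\<lambda>x. exp (g x + s * X x))"
        by (rule integrable_bounded[of _ "exp (c + 1)"]) (use sXc in auto)
      fix x
      have "exp (s * X x) \<le> 1 + s * X x + (s * X x)\<^sup>2"
        using sX(1)[of x] order_trans[OF sX(2)[of x] s(3)] by (rule exp_bound)
      also have "\<dots> \<le> 1 + s * X x + (s * B)\<^sup>2" using sX[of x] by (simp add: power_mono)
      finally show "exp (g x + s * X x) \<le> exp (g x) + s * (exp (g x) * X x) + exp (g x) * (s * B)\<^sup>2"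
        using mult_left_mono[of "exp (s * X x)" "1 + s * X x + (s * B)\<^sup>2" "exp (g x)"]
        by (simp add: exp_add algebra_simps)
    qed (use ig igX in auto)
    also have "\<dots> = 1 + s * Y + (s * B)\<^sup>2"
      using ig igX one by (simp add: Y_def)
    finally have 1: "(\<integral>x. exp (g x / t) \<partial>\<mu>) powr t \<le> 1 + s * Y + (s * B)\<^sup>2" .
    define y where "y = s / t * E"
    have y0: "y \<ge> 0" using s t E0 by (simp add: y_def)
    have ty: "t * y = s * E" using t by (simp add: y_def)
    have "1 + y = (\<integral>x. exp (g x) + s / t * (exp (g x) * g x) \<partial>\<mu>)"
      using ig igg one by (simp add: y_def E_def)
    also have "\<dots> \<le> (\<integral>x. exp (g x / t) \<partial>\<mu>)"
    proof (rule integral_mono)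
      show "integrable \<mu> (\<lambda>x. exp (g x / t))"
        by (rule integrable_bounded[of _ "exp (c / t)"]) (use t c in \<open>auto intro!: divide_right_mono simp: abs_le_iff\<close>)
      fix x
      \<comment> \<open>Splitting off \<open>e^g\<close> leaves a small exponent
        \<open>(s / t) g\<close>, for which \<open>1 + x <= e^x\<close> is a first-order
        expansion.\<close>
      have e: "g x / t = g x + s / t * g x" using t by (simp add: field_simps t_def)
      have "exp (g x) * (1 + s / t * g x) \<le> exp (g x) * exp (s / t * g x)"
        by (intro mult_left_mono exp_ge_add_one_self) auto
      then show "exp (g x) + s / t * (exp (g x) * g x) \<le> exp (g x / t)"
        unfolding e by (simp add: exp_add algebra_simps)
    qed (use ig igg in auto)
    finally have "(1 + y) powr t \<le> (\<integral>x. exp (g x / t) \<partial>\<mu>) powr t"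
      using y0 t by (intro powr_mono2) auto
    \<comment> \<open>With \<open>t = 1 - s\<close>, the power is \<open>(1 + y)\<close> times
      \<open>(1 + y) powr (- s)\<close>, and the latter is at least \<open>1 - s y\<close>. The
      first-order term of the product is \<open>t y = s E\<close>.\<close>
    moreover have "1 + s * E - s * y\<^sup>2 \<le> (1 + y) powr t"
    proof -
      have "ln (1 + y) \<le> y" using y0 by (rule ln_add_one_self_le_self)
      then have "s * ln (1 + y) \<le> s * y" using s by simp
      then have "1 - s * y \<le> 1 - s * ln (1 + y)" by simp
      also have "\<dots> \<le> exp (- (s * ln (1 + y)))" using exp_ge_add_one_self[of "- (s * ln (1 + y))"] by simp
      also have "\<dots> = (1 + y) powr (- s)" using y0 by (simp add: powr_def)
      finally have "(1 + y) * (1 - s * y) \<le> (1 + y) * (1 + y) powr (- s)" using y0 by (intro mult_left_mono) auto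
      also have "\<dots> = (1 + y) powr t" using y0 powr_add[of "1 + y" 1 "- s"] by (simp add: t_def)
      finally show ?thesis using ty by (simp add: t_def algebra_simps power2_eq_square)
    qed
    ultimately have "s * E \<le> s * Y + (s * B)\<^sup>2 + s * y\<^sup>2" using 1 by linarith
    also have "\<dots> = s * (Y + s * B\<^sup>2 + y\<^sup>2)" by (simp add: algebra_simps power2_eq_square)
    finally have "E \<le> Y + s * B\<^sup>2 + y\<^sup>2" using s by simp
    moreover have "y\<^sup>2 \<le> s * (4 * E\<^sup>2)"
    proof -
      have "y \<le> 2 * s * E" unfolding y_def using t s E0 by (intro mult_right_mono) (auto simp: field_simps)
      then have "y\<^sup>2 \<le> (2 * s * E)\<^sup>2" using y0 by (rule power_mono)
      also have "\<dots> = s * (s * (4 * E\<^sup>2))" by (simp add: power2_eq_square)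
      also have "\<dots> \<le> s * (1 * (4 * E\<^sup>2))" using s s0 by (intro mult_left_mono mult_right_mono) auto
      finally show ?thesis by simp
    qed
    ultimately show ?thesis by (simp add: algebra_simps)
  qed
  have "E \<le> Y"
  proof (rule tendsto_lowerbound)
    show "((\<lambda>s. Y + s * (B\<^sup>2 + 4 * E\<^sup>2)) \<longlongrightarrow> Y) (at_right 0)"
      by (auto intro!: tendsto_eq_intros)
    have "eventually (\<lambda>s. s \<in> {0<..<min s0 (1 / B)}) (at_right 0)"
      using s0 B by (intro eventually_at_right_real) auto
    then show "eventually (\<lambda>s. E \<le> Y + s * (B\<^sup>2 + 4 * E\<^sup>2)) (at_right 0)"
      by eventually_elim (rule key; use B in \<open>auto simp: field_simps\<close>)
  qed simp
  also have "Y = (\<integral>x. exp (g x) * ((norm (gg x))\<^sup>2 / (2 * \<rho>) + D) + \<eta> * exp (g x) \<partial>\<mu>)"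
    unfolding Y_def X_def by (simp add: algebra_simps)
  also have "\<dots> = (\<integral>x. exp (g x) * ((norm (gg x))\<^sup>2 / (2 * \<rho>) + D) \<partial>\<mu>) + \<eta>"
  proof (subst Bochner_Integration.integral_add)
    have "integrable \<mu> (\<lambda>x. exp (g x) * X x - \<eta> * exp (g x))" using igX ig by auto
    then show "integrable \<mu> (\<lambda>x. exp (g x) * ((norm (gg x))\<^sup>2 / (2 * \<rho>) + D))"
      unfolding X_def by (simp add: algebra_simps)
  qed (use ig one in auto)
  finally show "(\<integral>x. exp (g x) * g x \<partial>\<mu>) \<le> (\<integral>x. exp (g x) * ((norm (gg x))\<^sup>2 / (2 * \<rho>) + D) \<partial>\<mu>) + \<eta>"
    by (simp add: E_def)
qed

text \<open>Gibbs variational principle: \<open>a \<phi> <= a ln a - a + e^\<phi>\<close> with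
  \<open>a = e^g / F\<close>, integrated, bounds the left side by the entropy. Passing from
  \<open>g\<close> to \<open>g - ln F\<close> leaves the gradient unchanged, and the final
  inequality is homogeneous in \<open>e^g\<close>.\<close>

lemma entropy_bound_dual:
  fixes g :: "real^'n \<Rightarrow> real"
  assumes g: "\<And>x. GDERIV g x :> gg x" and c: "\<And>x. \<bar>g x\<bar> \<le> c" and L: "\<And>x. norm (gg x) \<le> L"
    and uc: "uniformly_continuous_on UNIV gg"
    and phi: "\<phi> \<in> borel_measurable borel" "\<And>x. \<bar>\<phi> x\<bar> \<le> b" "(\<integral>x. exp (\<phi> x) \<partial>\<mu>) \<le> 1"
  shows "(\<integral>x. exp (g x) * \<phi> x \<partial>\<mu>) \<le> (\<integral>x. exp (g x) * ((norm (gg x))\<^sup>2 / (2 * \<rho>) + D) \<partial>\<mu>)"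
proof -
  note [measurable] = phi(1)
  have [measurable]: "g \<in> borel_measurable borel"
    using GDERIV_imp_continuous_on[OF g] by (rule borel_measurable_continuous_onI)
  have eg: "exp (- c) \<le> exp (g x)" "exp (g x) \<le> exp c" for x using c[of x] by auto
  have ig: "integrable \<mu> (\<lambda>x. exp (g x))"
    by (rule integrable_bounded[of _ "exp c"]) (use eg in auto)
  define F where "F = (\<integral>x. exp (g x) \<partial>\<mu>)"
  have "(\<integral>x. exp (- c) \<partial>\<mu>) \<le> F" unfolding F_def by (rule integral_mono) (use ig eg in auto)
  then have F: "F > 0" using exp_gt_zero[of "- c"] by (simp del: exp_gt_zero)
  define g' where "g' = (\<lambda>x. g x - ln F)"
  have [measurable]: "g' \<in> borel_measurable borel" by (simp add: g'_def)
  have eg': "exp (g' x) = exp (g x) / F" for x using F by (simp add: g'_def exp_diff)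
  have c': "\<bar>g' x\<bar> \<le> c + \<bar>ln F\<bar>" for x using c[of x] by (simp add: g'_def)
  have dg': "GDERIV g' x :> gg x" for x
    unfolding g'_def by (rule GDERIV_subst[OF GDERIV_diff[OF g GDERIV_const]]) simp
  have one: "(\<integral>x. exp (g' x) \<partial>\<mu>) = 1" using F ig by (simp add: eg' F_def)
  have egb: "exp (g' x) \<le> exp (c + \<bar>ln F\<bar>)" for x using c'[of x] by simp
  have i1: "integrable \<mu> (\<lambda>x. exp (g' x) * \<phi> x)"
    by (rule integrable_bounded[of _ "exp (c + \<bar>ln F\<bar>) * b"]) (auto simp: abs_mult intro!: mult_mono phi egb)
  have i2: "integrable \<mu> (\<lambda>x. exp (g' x) * g' x)"
    by (rule integrable_bounded[of _ "exp (c + \<bar>ln F\<bar>) * (c + \<bar>ln F\<bar>)"]) (auto simp: abs_mult intro!: mult_mono c' egb)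
  have i3: "integrable \<mu> (\<lambda>x. exp (g' x))"
    by (rule integrable_bounded[of _ "exp (c + \<bar>ln F\<bar>)"]) (use egb in auto)
  have i4: "integrable \<mu> (\<lambda>x. exp (\<phi> x))"
    by (rule integrable_bounded[of _ "exp b"]) (use phi in \<open>auto simp: abs_le_iff\<close>)
  have "(\<integral>x. exp (g' x) * \<phi> x \<partial>\<mu>) \<le> (\<integral>x. exp (g' x) * g' x - exp (g' x) + exp (\<phi> x) \<partial>\<mu>)"
  proof (rule integral_mono)
    fix x
    have "exp (g' x) * (1 + (\<phi> x - g' x)) \<le> exp (g' x) * exp (\<phi> x - g' x)"
      by (intro mult_left_mono exp_ge_add_one_self) auto
    then show "exp (g' x) * \<phi> x \<le> exp (g' x) * g' x - exp (g' x) + exp (\<phi> x)"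
      by (simp add: exp_add[symmetric] algebra_simps)
  qed (use i1 i2 i3 i4 in auto)
  also have "\<dots> = (\<integral>x. exp (g' x) * g' x \<partial>\<mu>) - 1 + (\<integral>x. exp (\<phi> x) \<partial>\<mu>)"
    using i2 i3 i4 one by simp
  also have "\<dots> \<le> (\<integral>x. exp (g' x) * g' x \<partial>\<mu>)" using phi by simp
  also have "\<dots> \<le> (\<integral>x. exp (g' x) * ((norm (gg x))\<^sup>2 / (2 * \<rho>) + D) \<partial>\<mu>)"
    by (rule entropy_bound_normalized[OF dg' c' L uc one])
  finally have "(\<integral>x. exp (g x) * \<phi> x / F \<partial>\<mu>) \<le> (\<integral>x. exp (g x) * ((norm (gg x))\<^sup>2 / (2 * \<rho>) + D) / F \<partial>\<mu>)"
    unfolding eg' by simp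
  then show ?thesis using F by (simp only: integral_divide_zero divide_le_cancel)
qed

end

subsection \<open>The defective logarithmic Sobolev inequality\<close>

lemma DERIV_if_quadratic_bound:
  fixes f :: "real \<Rightarrow> real"
  assumes "\<And>y. \<bar>f y - f x - d * (y - x)\<bar> \<le> (y - x)\<^sup>2"
  shows "(f has_real_derivative d) (at x)"
proof -
  have "((\<lambda>h. (f (x + h) - f x) / h - d) \<longlongrightarrow> 0) (at 0)"
  proof (rule Lim_null_comparison)
    show "eventually (\<lambda>h. norm ((f (x + h) - f x) / h - d) \<le> \<bar>h\<bar>) (at 0)"
      unfolding eventually_at_filter
    proof (rule always_eventually, intro allI impI)
      fix h :: real assume h: "h \<noteq> 0"
      have "(f (x + h) - f x) / h - d = (f (x + h) - f x - d * h) / h" using h by (simp add: field_simps)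
      moreover have "\<bar>f (x + h) - f x - d * h\<bar> \<le> \<bar>h\<bar> * \<bar>h\<bar>"
        using assms[of "x + h"] by (simp add: power2_eq_square abs_mult[symmetric])
      ultimately show "norm ((f (x + h) - f x) / h - d) \<le> \<bar>h\<bar>" using h by (simp add: field_simps)
    qed
    show "((\<lambda>h::real. \<bar>h\<bar>) \<longlongrightarrow> 0) (at 0)" by (auto intro!: tendsto_eq_intros)
  qed
  then show ?thesis unfolding DERIV_def by (simp add: LIM_zero_iff)
qed

text \<open>Squaring removes the kink of the positive part at 0. This serves both the spatial cutoff
  and the smoothing of the positive part of a test function.\<close>

lemma DERIV_pos_part_squared: "((\<lambda>u::real. (max 0 u)\<^sup>2) has_real_derivative 2 * max 0 u) (at u)"
proof (rule DERIV_if_quadratic_bound)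
  fix y :: real
  consider "u \<ge> 0" "y \<ge> 0" | "u \<ge> 0" "y < 0" | "u < 0" "y \<ge> 0" | "u < 0" "y < 0" by linarith
  then show "\<bar>(max 0 y)\<^sup>2 - (max 0 u)\<^sup>2 - 2 * max 0 u * (y - u)\<bar> \<le> (y - u)\<^sup>2"
  proof cases
    case 1
    have "y\<^sup>2 - u\<^sup>2 - 2 * u * (y - u) = (y - u)\<^sup>2" by (simp add: power2_eq_square algebra_simps)
    then show ?thesis using 1 by simp
  next
    case 2
    then have "u * y \<le> 0" by (simp add: mult_nonneg_nonpos)
    moreover have "0 \<le> u * u" "0 \<le> y * y" by auto
    moreover have "(max 0 y)\<^sup>2 - (max 0 u)\<^sup>2 - 2 * max 0 u * (y - u) = u * u - 2 * (u * y)"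
      using 2 by (simp add: power2_eq_square algebra_simps)
    moreover have "(y - u)\<^sup>2 = u * u - 2 * (u * y) + y * y" by (simp add: power2_eq_square algebra_simps)
    ultimately show ?thesis by linarith
  next
    case 3 then have "y\<^sup>2 \<le> (y - u)\<^sup>2" by (intro power_mono) auto
    then show ?thesis using 3 by simp
  next
    case 4 then show ?thesis by simp
  qed
qed

lemma compact_support_bounded:
  fixes f :: "'a::euclidean_space \<Rightarrow> 'b::real_normed_vector"
  assumes "continuous_on UNIV f" "\<And>x. norm x > k \<Longrightarrow> f x = c"
  obtains L where "\<And>x. norm (f x) \<le> L"
proof -
  have "bounded (f ` cball 0 k)"
    by (intro compact_imp_bounded compact_continuous_image continuous_on_subset[OF assms(1)]) auto
  then obtain B where "\<And>x. x \<in> cball 0 k \<Longrightarrow> norm (f x) \<le> B" unfolding bounded_iff by blast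
  then have "norm (f x) \<le> max B (norm c)" for x
    using assms(2)[of x] by (cases "norm x > k") (auto simp: le_max_iff_disj)
  then show ?thesis by (rule that)
qed

lemma compact_support_uniformly_continuous:
  fixes f :: "'a::euclidean_space \<Rightarrow> 'b::real_normed_vector"
  assumes c: "continuous_on UNIV f" and z: "\<And>x. norm x > k \<Longrightarrow> f x = 0"
  shows "uniformly_continuous_on UNIV f"
proof (unfold uniformly_continuous_on_def, intro allI impI)
  fix e :: real assume e: "e > 0"
  have "uniformly_continuous_on (cball 0 (k + 1)) f"
    by (intro compact_uniformly_continuous continuous_on_subset[OF c]) auto
  then obtain d where d: "d > 0" "\<And>x y. x \<in> cball 0 (k + 1) \<Longrightarrow> y \<in> cball 0 (k + 1) \<Longrightarrow> dist y x < d \<Longrightarrow> dist (f y) (f x) < e"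
    using e unfolding uniformly_continuous_on_def by metis
  show "\<exists>d>0. \<forall>x\<in>UNIV. \<forall>y\<in>UNIV. dist y x < d \<longrightarrow> dist (f y) (f x) < e"
  proof (intro exI[of _ "min d 1"] conjI ballI impI)
    fix x y :: 'a assume xy: "dist y x < min d 1"
    show "dist (f y) (f x) < e"
    proof (cases "norm x \<le> k + 1 \<and> norm y \<le> k + 1")
      case True then show ?thesis using d xy by auto
    next
      case False
      have "\<bar>norm y - norm x\<bar> < 1" using xy norm_triangle_ineq3[of y x] by (simp add: dist_norm)
      then have "norm x > k" "norm y > k" using False by linarith+
      then show ?thesis using z e by simp
    qed
  qed (use d in auto)
qed

text \<open>A squared truncated paraboloid is only continuously differentiable, but this is all that
  the entropy bound asks for, and its gradient has norm at most \<open>4 / k\<close> for positive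
  \<open>k\<close>.\<close>

lemma GDERIV_cutoff:
  fixes x :: "'a::real_inner" and k :: real
  shows "GDERIV (\<lambda>x. (max 0 (1 - (x \<bullet> x) / k\<^sup>2))\<^sup>2) x :> (- (4 * max 0 (1 - (x \<bullet> x) / k\<^sup>2) / k\<^sup>2)) *\<^sub>R x"
proof -
  have "GDERIV (\<lambda>x. 1 - (x \<bullet> x) * c) x :> (- (2 * c)) *\<^sub>R x" for c :: real
    unfolding gderiv_def
    by (auto intro!: derivative_eq_intros simp: inner_commute fun_eq_iff algebra_simps)
  from GDERIV_DERIV_compose[OF this DERIV_pos_part_squared, of "1 / k\<^sup>2"]
  show ?thesis by (simp add: algebra_simps)
qed

context defect_convex
begin

text \<open>The entropy bound is applied to \<open>ln (F^2 + 1 / k^2)\<close>. The summand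
  \<open>1 / k^2\<close> keeps the logarithm finite, and the cutoff makes it constant outside a
  ball, so it is bounded with a bounded, uniformly continuous gradient.\<close>

lemma defective_log_sobolev_cutoff:
  fixes f :: "real^'n \<Rightarrow> real" and k :: real
  defines "F \<equiv> \<lambda>x. (max 0 (1 - (x \<bullet> x) / k\<^sup>2))\<^sup>2 * f x"
  assumes f: "test_fun \<mu> f gf" and k: "k \<ge> 1"
    and phi: "\<phi> \<in> borel_measurable borel" "\<And>x. \<bar>\<phi> x\<bar> \<le> b" "(\<integral>x. exp (\<phi> x) \<partial>\<mu>) \<le> 1"
  shows "(\<integral>x. ((F x)\<^sup>2 + 1 / k\<^sup>2) * \<phi> x \<partial>\<mu>)
    \<le> 2 / \<rho> * ((1 + 1 / k) * (\<integral>x. (norm (gf x))\<^sup>2 \<partial>\<mu>) + 16 * (1 + k) / k\<^sup>2 * (\<integral>x. (f x)\<^sup>2 \<partial>\<mu>))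
       + D * ((\<integral>x. (f x)\<^sup>2 \<partial>\<mu>) + 1 / k\<^sup>2)"
proof -
  have df: "\<And>x. GDERIV f x :> gf x" and cgf: "continuous_on UNIV gf"
    and if2: "integrable \<mu> (\<lambda>x. (f x)\<^sup>2)" and ig2: "integrable \<mu> (\<lambda>x. (norm (gf x))\<^sup>2)"
    using f by (auto simp: test_fun_def)
  have cf: "continuous_on UNIV f" by (rule GDERIV_imp_continuous_on[OF df])
  have [measurable]: "f \<in> borel_measurable borel" "gf \<in> borel_measurable borel"
    using cf cgf by (auto intro: borel_measurable_continuous_onI)
  define P where "P = (\<lambda>x::real^'n. max 0 (1 - (x \<bullet> x) / k\<^sup>2))"
  have P: "0 \<le> P x" "P x \<le> 1" for x by (auto simp: P_def)
  have P0: "P x = 0" if "norm x \<ge> k" for x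
  proof -
    have "k\<^sup>2 \<le> x \<bullet> x" using that k by (simp add: power2_norm_eq_inner[symmetric] power_mono)
    then show ?thesis using k by (simp add: P_def)
  qed
  have cP: "continuous_on UNIV P" unfolding P_def using k by (intro continuous_intros) auto
  define gF where "gF = (\<lambda>x. (P x)\<^sup>2 *\<^sub>R gf x + f x *\<^sub>R ((- (4 * P x / k\<^sup>2)) *\<^sub>R x))"
  have F: "F = (\<lambda>x. (P x)\<^sup>2 * f x)" by (simp add: F_def P_def)
  have dF: "GDERIV F x :> gF x" for x
    unfolding F_def gF_def P_def by (intro GDERIV_mult GDERIV_cutoff df)
  have cF: "continuous_on UNIV F" by (rule GDERIV_imp_continuous_on[OF dF])
  have cgF: "continuous_on UNIV gF" unfolding gF_def using k by (intro continuous_intros cP cf cgf) auto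
  have [measurable]: "F \<in> borel_measurable borel" "gF \<in> borel_measurable borel"
    using cF cgF by (auto intro: borel_measurable_continuous_onI)
  define q where "q = 1 / k\<^sup>2"
  have q: "q > 0" using k by (simp add: q_def)
  have Fq: "(F x)\<^sup>2 + q > 0" for x using q by (simp add: add_nonneg_pos)
  define g where "g = (\<lambda>x. ln ((F x)\<^sup>2 + q))"
  define gg where "gg = (\<lambda>x. (2 * F x / ((F x)\<^sup>2 + q)) *\<^sub>R gF x)"
  have eg: "exp (g x) = (F x)\<^sup>2 + q" for x using Fq by (simp add: g_def)
  have dg: "GDERIV g x :> gg x" for x
  proof -
    have "((\<lambda>y. ln (y\<^sup>2 + q)) has_real_derivative 2 * F x / ((F x)\<^sup>2 + q)) (at (F x))"
      using Fq[of x] by (auto intro!: derivative_eq_intros simp: field_simps)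
    from GDERIV_DERIV_compose[OF dF this] show ?thesis unfolding g_def gg_def .
  qed
  have cgg: "continuous_on UNIV gg" unfolding gg_def using Fq
    by (intro continuous_intros cF cgF) (auto simp: less_imp_neq[THEN not_sym])
  have cg: "continuous_on UNIV g" by (rule GDERIV_imp_continuous_on[OF dg])
  have g0: "g x = ln q" "gg x = 0" if "norm x > k" for x
    using P0[of x] that by (auto simp: g_def gg_def F)
  obtain c where c: "\<And>x. norm (g x) \<le> c" using compact_support_bounded[OF cg g0(1)] by blast
  obtain L where L: "\<And>x. norm (gg x) \<le> L" using compact_support_bounded[OF cgg g0(2)] by blast
  have uc: "uniformly_continuous_on UNIV gg" by (rule compact_support_uniformly_continuous[OF cgg g0(2)])
  have F2: "(F x)\<^sup>2 \<le> (f x)\<^sup>2" for x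
  proof -
    have "\<bar>F x\<bar> \<le> 1 * \<bar>f x\<bar>" unfolding F abs_mult using P[of x] by (intro mult_right_mono) (auto simp: power_le_one)
    then show ?thesis by (simp add: abs_le_square_iff)
  qed
  have gF2: "(norm (gF x))\<^sup>2 \<le> (1 + 1 / k) * (norm (gf x))\<^sup>2 + 16 * (1 + k) / k\<^sup>2 * (f x)\<^sup>2" for x
  proof -
    have "norm (P x *\<^sub>R x) \<le> k"
    proof (cases "norm x \<ge> k")
      case True then show ?thesis using P0[of x] k by simp
    next
      case False
      have "norm (P x *\<^sub>R x) \<le> norm x" using P[of x] by (simp add: mult_left_le_one_le)
      then show ?thesis using False by simp
    qed
    then have "\<bar>f x\<bar> * (4 * norm (P x *\<^sub>R x) / k\<^sup>2) \<le> \<bar>f x\<bar> * (4 * k / k\<^sup>2)"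
      using k by (intro mult_left_mono divide_right_mono) auto
    also have "\<dots> = 4 * \<bar>f x\<bar> / k" using k by (simp add: power2_eq_square)
    finally have 2: "norm (f x *\<^sub>R ((- (4 * P x / k\<^sup>2)) *\<^sub>R x)) \<le> 4 * \<bar>f x\<bar> / k" by (simp add: abs_mult)
    have 1: "norm ((P x)\<^sup>2 *\<^sub>R gf x) \<le> norm (gf x)"
      using P[of x] mult_right_mono[of "(P x)\<^sup>2" 1 "norm (gf x)"] by (simp add: power_le_one)
    define a where "a = norm (gf x)"
    define e where "e = 4 * \<bar>f x\<bar> / k"
    have "norm (gF x) \<le> a + e"
      unfolding gF_def a_def e_def by (rule order_trans[OF norm_triangle_ineq add_mono[OF 1 2]])
    then have "(norm (gF x))\<^sup>2 \<le> (a + e)\<^sup>2" by (intro power_mono) auto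
    \<comment> \<open>Young's inequality with weight \<open>k\<close>: the factor of the true
      gradient tends to 1, while \<open>(1 + k) e^2\<close> is of order \<open>1 / k\<close> because
      \<open>e\<close> already carries a factor \<open>1 / k\<close>.\<close>
    also have "\<dots> \<le> (1 + 1 / k) * a\<^sup>2 + (1 + k) * e\<^sup>2"
    proof -
      have "0 \<le> (a - k * e)\<^sup>2 / k" using k by simp
      also have "\<dots> = (1 + 1 / k) * a\<^sup>2 + (1 + k) * e\<^sup>2 - (a + e)\<^sup>2"
        using k by (simp add: field_simps power2_eq_square)
      finally show ?thesis by simp
    qed
    also have "(1 + k) * e\<^sup>2 = 16 * (1 + k) / k\<^sup>2 * (f x)\<^sup>2"
      unfolding e_def by (simp add: power_divide power_mult_distrib)
    finally show ?thesis unfolding a_def .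
  qed
  have half: "4 * w / (2 * \<rho>) = 2 / \<rho> * w" for w :: real by simp
  have "(\<integral>x. ((F x)\<^sup>2 + q) * \<phi> x \<partial>\<mu>) \<le> (\<integral>x. exp (g x) * ((norm (gg x))\<^sup>2 / (2 * \<rho>) + D) \<partial>\<mu>)"
    unfolding eg[symmetric]
    by (rule entropy_bound_dual[OF dg _ L uc phi]) (use c in auto)
  also have "\<dots> \<le> (\<integral>x. 2 / \<rho> * ((1 + 1 / k) * (norm (gf x))\<^sup>2 + 16 * (1 + k) / k\<^sup>2 * (f x)\<^sup>2) + D * ((f x)\<^sup>2 + q) \<partial>\<mu>)"
  proof (rule integral_mono)
    have [measurable]: "g \<in> borel_measurable borel" "gg \<in> borel_measurable borel"
      using cg cgg by (auto intro: borel_measurable_continuous_onI)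
    have "exp (g x) \<le> exp c" for x using c[of x] by (simp add: abs_le_iff)
    moreover have "\<bar>(norm (gg x))\<^sup>2 / (2 * \<rho>) + D\<bar> \<le> L\<^sup>2 / (2 * \<rho>) + D" for x
      using L[of x] rho D by (simp add: divide_right_mono power_mono)
    ultimately show "integrable \<mu> (\<lambda>x. exp (g x) * ((norm (gg x))\<^sup>2 / (2 * \<rho>) + D))"
      by (intro integrable_bounded[of _ "exp c * (L\<^sup>2 / (2 * \<rho>) + D)"]) (auto simp: abs_mult intro!: mult_mono)
    show "integrable \<mu> (\<lambda>x. 2 / \<rho> * ((1 + 1 / k) * (norm (gf x))\<^sup>2 + 16 * (1 + k) / k\<^sup>2 * (f x)\<^sup>2) + D * ((f x)\<^sup>2 + q))"
      by (intro Bochner_Integration.integrable_add integrable_mult_right if2 ig2) auto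
    fix x
    \<comment> \<open>The weight \<open>e^g\<close> cancels one denominator, giving at most
      \<open>4 |gF|^2\<close>. Divided by \<open>2 \<rho>\<close>, this is the origin of the
      constant \<open>2 / \<rho>\<close>.\<close>
    have "exp (g x) * (norm (gg x))\<^sup>2 = 4 * ((F x)\<^sup>2 / ((F x)\<^sup>2 + q)) * (norm (gF x))\<^sup>2"
      unfolding eg gg_def using Fq[of x] by (simp add: power_mult_distrib power_divide power2_eq_square abs_mult)
    also have "\<dots> \<le> 4 * 1 * (norm (gF x))\<^sup>2"
      using Fq[of x] q by (intro mult_right_mono mult_left_mono) auto
    also have "\<dots> \<le> 4 * ((1 + 1 / k) * (norm (gf x))\<^sup>2 + 16 * (1 + k) / k\<^sup>2 * (f x)\<^sup>2)" using gF2[of x] by simp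
    finally have "exp (g x) * (norm (gg x))\<^sup>2 / (2 * \<rho>) \<le> 4 * ((1 + 1 / k) * (norm (gf x))\<^sup>2 + 16 * (1 + k) / k\<^sup>2 * (f x)\<^sup>2) / (2 * \<rho>)"
      using rho by (intro divide_right_mono) auto
    also have "\<dots> = 2 / \<rho> * ((1 + 1 / k) * (norm (gf x))\<^sup>2 + 16 * (1 + k) / k\<^sup>2 * (f x)\<^sup>2)"
      using half[of "(1 + 1 / k) * (norm (gf x))\<^sup>2 + 16 * (1 + k) / k\<^sup>2 * (f x)\<^sup>2"] .
    finally have "exp (g x) * (norm (gg x))\<^sup>2 / (2 * \<rho>) \<le> 2 / \<rho> * ((1 + 1 / k) * (norm (gf x))\<^sup>2 + 16 * (1 + k) / k\<^sup>2 * (f x)\<^sup>2)" .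
    moreover have "exp (g x) * D \<le> D * ((f x)\<^sup>2 + q)"
      unfolding eg using mult_left_mono[OF F2[of x] D] by (simp add: algebra_simps)
    ultimately show "exp (g x) * ((norm (gg x))\<^sup>2 / (2 * \<rho>) + D)
       \<le> 2 / \<rho> * ((1 + 1 / k) * (norm (gf x))\<^sup>2 + 16 * (1 + k) / k\<^sup>2 * (f x)\<^sup>2) + D * ((f x)\<^sup>2 + q)"
      unfolding distrib_left[of "exp (g x)"] times_divide_eq_right[symmetric] by simp
  qed
  also have "\<dots> = 2 / \<rho> * ((1 + 1 / k) * (\<integral>x. (norm (gf x))\<^sup>2 \<partial>\<mu>) + 16 * (1 + k) / k\<^sup>2 * (\<integral>x. (f x)\<^sup>2 \<partial>\<mu>))
       + D * ((\<integral>x. (f x)\<^sup>2 \<partial>\<mu>) + q)"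
    using if2 ig2 by simp
  finally show ?thesis unfolding q_def .
qed

text \<open>The entropy of \<open>f\<^sup>2\<close> is replaced by its dual expression as the supremum of \<open>\<integral> f\<^sup>2 \<phi>\<close>; in this form it is stable under limits
  and needs no integrability of \<open>f\<^sup>2 ln f\<^sup>2\<close>.\<close>

lemma defective_log_sobolev:
  fixes f :: "real^'n \<Rightarrow> real"
  assumes f: "test_fun \<mu> f gf"
    and phi: "\<phi> \<in> borel_measurable borel" "\<And>x. \<bar>\<phi> x\<bar> \<le> b" "(\<integral>x. exp (\<phi> x) \<partial>\<mu>) \<le> 1"
  shows "(\<integral>x. (f x)\<^sup>2 * \<phi> x \<partial>\<mu>) \<le> 2 / \<rho> * (\<integral>x. (norm (gf x))\<^sup>2 \<partial>\<mu>) + D * (\<integral>x. (f x)\<^sup>2 \<partial>\<mu>)"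
proof -
  have df: "\<And>x. GDERIV f x :> gf x" and if2: "integrable \<mu> (\<lambda>x. (f x)\<^sup>2)"
    using f by (auto simp: test_fun_def)
  have [measurable]: "f \<in> borel_measurable borel"
    using GDERIV_imp_continuous_on[OF df] by (rule borel_measurable_continuous_onI)
  note [measurable] = phi(1)
  define k where "k = (\<lambda>n. real (Suc n))"
  define F where "F = (\<lambda>n (x::real^'n). (max 0 (1 - (x \<bullet> x) / (k n)\<^sup>2))\<^sup>2 * f x)"
  have k: "k n \<ge> 1" for n by (simp add: k_def)
  have klim: "(\<lambda>n. 1 / k n) \<longlonglongrightarrow> 0" unfolding k_def using LIMSEQ_inverse_real_of_nat by (simp add: inverse_eq_divide)
  have k2lim: "(\<lambda>n. 1 / (k n)\<^sup>2) \<longlonglongrightarrow> 0" using tendsto_power[OF klim, of 2] by (simp add: power_divide)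
  have rl: "(\<lambda>n. 2 / \<rho> * ((1 + 1 / k n) * (\<integral>x. (norm (gf x))\<^sup>2 \<partial>\<mu>) + (16 * (1 / (k n)\<^sup>2) + 16 * (1 / k n)) * (\<integral>x. (f x)\<^sup>2 \<partial>\<mu>))
       + D * ((\<integral>x. (f x)\<^sup>2 \<partial>\<mu>) + 1 / (k n)\<^sup>2))
     \<longlonglongrightarrow> 2 / \<rho> * ((1 + 0) * (\<integral>x. (norm (gf x))\<^sup>2 \<partial>\<mu>) + (16 * 0 + 16 * 0) * (\<integral>x. (f x)\<^sup>2 \<partial>\<mu>))
       + D * ((\<integral>x. (f x)\<^sup>2 \<partial>\<mu>) + 0)"
    by (intro tendsto_intros klim k2lim)
  have ll: "(\<lambda>n. \<integral>x. ((F n x)\<^sup>2 + 1 / (k n)\<^sup>2) * \<phi> x \<partial>\<mu>) \<longlonglongrightarrow> (\<integral>x. (f x)\<^sup>2 * \<phi> x \<partial>\<mu>)"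
  proof (rule integral_dominated_convergence[where w = "\<lambda>x. ((f x)\<^sup>2 + 1) * b"])
    show "integrable \<mu> (\<lambda>x. ((f x)\<^sup>2 + 1) * b)" using if2 by simp
    show "AE x in \<mu>. (\<lambda>n. ((F n x)\<^sup>2 + 1 / (k n)\<^sup>2) * \<phi> x) \<longlonglongrightarrow> (f x)\<^sup>2 * \<phi> x"
    proof (rule AE_I2)
      fix x :: "real^'n"
      have "(\<lambda>n. (((max 0 (1 - (x \<bullet> x) * (1 / (k n)\<^sup>2)))\<^sup>2 * f x)\<^sup>2 + 1 / (k n)\<^sup>2) * \<phi> x)
         \<longlonglongrightarrow> (((max 0 (1 - (x \<bullet> x) * 0))\<^sup>2 * f x)\<^sup>2 + 0) * \<phi> x"
        by (intro tendsto_intros k2lim)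
      then show "(\<lambda>n. ((F n x)\<^sup>2 + 1 / (k n)\<^sup>2) * \<phi> x) \<longlonglongrightarrow> (f x)\<^sup>2 * \<phi> x" by (simp add: F_def)
    qed
    show "AE x in \<mu>. norm (((F n x)\<^sup>2 + 1 / (k n)\<^sup>2) * \<phi> x) \<le> ((f x)\<^sup>2 + 1) * b" for n
    proof (rule AE_I2)
      fix x :: "real^'n"
      have "max 0 (1 - (x \<bullet> x) / (k n)\<^sup>2) \<le> 1" by simp
      then have "\<bar>F n x\<bar> \<le> 1 * \<bar>f x\<bar>" unfolding F_def abs_mult by (intro mult_right_mono) (auto simp: power_le_one)
      then have "(F n x)\<^sup>2 \<le> (f x)\<^sup>2" by (simp add: abs_le_square_iff)
      moreover have "1 / (k n)\<^sup>2 \<le> 1" using k[of n] by simp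
      ultimately have "((F n x)\<^sup>2 + 1 / (k n)\<^sup>2) * \<bar>\<phi> x\<bar> \<le> ((f x)\<^sup>2 + 1) * b"
        using phi(2)[of x] by (intro mult_mono) auto
      then show "norm (((F n x)\<^sup>2 + 1 / (k n)\<^sup>2) * \<phi> x) \<le> ((f x)\<^sup>2 + 1) * b" by (simp add: abs_mult)
    qed
  qed (auto simp: F_def)
  have "(\<integral>x. ((F n x)\<^sup>2 + 1 / (k n)\<^sup>2) * \<phi> x \<partial>\<mu>)
     \<le> 2 / \<rho> * ((1 + 1 / k n) * (\<integral>x. (norm (gf x))\<^sup>2 \<partial>\<mu>) + (16 * (1 / (k n)\<^sup>2) + 16 * (1 / k n)) * (\<integral>x. (f x)\<^sup>2 \<partial>\<mu>))
       + D * ((\<integral>x. (f x)\<^sup>2 \<partial>\<mu>) + 1 / (k n)\<^sup>2)" for n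
  proof -
    have "16 * (1 / (k n)\<^sup>2) + 16 * (1 / k n) = 16 * (1 + k n) / (k n)\<^sup>2"
      using k[of n] by (simp add: field_simps power2_eq_square)
    then show ?thesis
      using defective_log_sobolev_cutoff[OF f k phi, of n] unfolding F_def by simp
  qed
  then show ?thesis
    using LIMSEQ_le[OF ll rl] by simp
qed

end

subsection \<open>Poincare and tight logarithmic Sobolev inequalities\<close>

lemma (in prob_space) median_exists:
  fixes f :: "'a \<Rightarrow> real"
  assumes [measurable]: "f \<in> borel_measurable M"
  obtains m where "prob {x \<in> space M. m < f x} \<le> 1/2" "prob {x \<in> space M. f x < m} \<le> 1/2"
proof -
  interpret D: real_distribution "distr M borel f" by (rule real_distribution_distr) simp
  define C where "C = cdf (distr M borel f)"
  define S where "S = {t. 1/2 \<le> C t}"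
  have "eventually (\<lambda>t. 1/2 < C t) at_top"
    using D.cdf_lim_at_top_prob unfolding C_def by (rule order_tendstoD) simp
  then obtain t1 where "1/2 < C t1" by (auto simp: eventually_at_top_linorder)
  then have ne: "S \<noteq> {}" unfolding S_def by (auto intro: less_imp_le)
  have "eventually (\<lambda>t. C t < 1/2) at_bot"
    using D.cdf_lim_at_bot unfolding C_def by (rule order_tendstoD) simp
  then obtain t2 where t2: "\<And>t. t \<le> t2 \<Longrightarrow> C t < 1/2" by (auto simp: eventually_at_bot_linorder)
  then have bb: "bdd_below S" unfolding S_def by (intro bdd_belowI[of _ t2]) (force simp: not_less[symmetric])
  define m where "m = Inf S"
  have up: "1/2 \<le> C t" if t: "t > m" for t
  proof -
    obtain s where "s \<in> S" "s < t" using cInf_less_iff[OF ne bb, of t] t unfolding m_def by blast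
    then show ?thesis using D.cdf_nondecreasing[of s t] unfolding S_def C_def by auto
  qed
  have dn: "C t \<le> 1/2" if "t < m" for t
    using cInf_lower[OF _ bb, of t] that unfolding m_def S_def by force
  have "1/2 \<le> C m"
  \<comment> \<open>With \<open>m\<close> the infimum of the points where the distribution function
    reaches 1/2, right continuity controls the mass up to \<open>m\<close>; the left limit below
    controls the mass strictly before it.\<close>
  proof (rule tendsto_lowerbound)
    show "(C \<longlongrightarrow> C m) (at_right m)"
      using D.cdf_is_right_cont[of m] unfolding C_def continuous_within .
    show "eventually (\<lambda>t. 1/2 \<le> C t) (at_right m)"
      using eventually_at_right_less[of m] by eventually_elim (rule up)
  qed simp
  moreover have "D.prob {..<m} \<le> 1/2"
  proof (rule tendsto_upperbound)
    show "(C \<longlongrightarrow> D.prob {..<m}) (at_left m)" using D.cdf_at_left[of m] unfolding C_def .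
    have "eventually (\<lambda>t. t < m) (at_left m)" by (simp add: eventually_at_filter)
    then show "eventually (\<lambda>t. C t \<le> 1/2) (at_left m)" by eventually_elim (rule dn)
  qed simp
  moreover have "D.prob {..<m} = prob {x \<in> space M. f x < m}"
    by (simp add: measure_distr vimage_def Int_def conj_commute)
  moreover have "C m = prob {x \<in> space M. f x \<le> m}"
    unfolding C_def cdf_def by (simp add: measure_distr vimage_def Int_def conj_commute)
  moreover have "prob {x \<in> space M. m < f x} = 1 - prob {x \<in> space M. f x \<le> m}"
    by (subst prob_neg[symmetric]) (auto simp: not_le)
  ultimately show ?thesis by (intro that[of m]) auto
qed

section \<open>Scalar inequalities for the logarithm\<close>

text \<open>The right side agrees with \<open>ln\<close> to second order at 1, as does the bound for
  \<open>x \<le> 1\<close> in the next lemma. The cruder \<open>ln x <= x - 1\<close> would be too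
  weak for the quadratic term in \<open>square_entropy_le\<close>.\<close>

lemma ln_le_half_diff_inverse:
  fixes x :: real
  assumes "x \<ge> 1"
  shows "ln x \<le> (x - 1 / x) / 2"
proof -
  have "(1 - 1 / 1) / 2 - ln 1 \<le> (x - 1 / x) / 2 - ln x"
  proof (rule DERIV_nonneg_imp_nondecreasing[OF assms])
    fix y :: real assume y: "1 \<le> y" "y \<le> x"
    have "((\<lambda>x. (x - 1 / x) / 2 - ln x) has_real_derivative (1 + 1 / y\<^sup>2) / 2 - 1 / y) (at y)"
      using y by (auto intro!: derivative_eq_intros simp: power2_eq_square)
    moreover have "(1 + 1 / y\<^sup>2) / 2 - 1 / y = (1 - 1 / y)\<^sup>2 / 2"
      using y by (simp add: power2_eq_square field_simps)
    ultimately show "\<exists>d. ((\<lambda>x. (x - 1 / x) / 2 - ln x) has_real_derivative d) (at y) \<and> 0 \<le> d"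
      by (metis divide_nonneg_pos zero_le_power2 zero_less_numeral)
  qed
  then show ?thesis by simp
qed

lemma ln_le_two_diff_over_sum:
  fixes x :: real
  assumes "0 < x" "x \<le> 1"
  shows "ln x \<le> 2 * (x - 1) / (x + 1)"
proof -
  have "2 * (1 - 1) / (1 + 1) - ln 1 \<le> 2 * (x - 1) / (x + 1) - ln x"
  proof (rule DERIV_nonpos_imp_nonincreasing[OF assms(2)])
    fix y :: real assume y: "x \<le> y" "y \<le> 1"
    have "((\<lambda>x. 2 * (x - 1) / (x + 1) - ln x) has_real_derivative 4 / (y + 1)\<^sup>2 - 1 / y) (at y)"
      using y assms by (auto intro!: derivative_eq_intros simp: power2_eq_square)
    moreover have "4 / (y + 1)\<^sup>2 - 1 / y = - ((y - 1)\<^sup>2 / (y * (y + 1)\<^sup>2))"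
      using y assms by (simp add: power2_eq_square divide_simps) (simp add: algebra_simps)
    moreover have "- ((y - 1)\<^sup>2 / (y * (y + 1)\<^sup>2)) \<le> 0" using y assms by simp
    ultimately show "\<exists>d. ((\<lambda>x. 2 * (x - 1) / (x + 1) - ln x) has_real_derivative d) (at y) \<and> d \<le> 0"
      by metis
  qed
  then show ?thesis by simp
qed

text \<open>Pointwise comparison of the entropy integrand of \<open>f\<close> with one for
  \<open>h = f - 1\<close>. The coefficient 2 is forced, since the left side behaves like
  \<open>2 h^2\<close> near \<open>f = 1\<close>. Using \<open>1 + \<bar>h\<bar>\<close> inside the
  logarithm keeps it nonnegative and increasing in \<open>\<bar>h\<bar>\<close>, so \<open>h\<close>
  may be replaced by the smaller \<open>b = \<bar>\<bar>f\<bar> - 1\<bar>\<close>.\<close>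

lemma square_entropy_le:
  fixes f :: real
  defines "h \<equiv> f - 1"
  shows "f\<^sup>2 * ln (f\<^sup>2) - f\<^sup>2 + 1 \<le> h\<^sup>2 * ln ((1 + \<bar>h\<bar>)\<^sup>2) + 2 * h\<^sup>2"
proof -
  define b where "b = \<bar>\<bar>f\<bar> - 1\<bar>"
  have b0: "b \<ge> 0" and bh: "b \<le> \<bar>h\<bar>" unfolding b_def h_def by auto
  have "b\<^sup>2 \<le> h\<^sup>2" using bh b0 by (metis abs_le_square_iff abs_of_nonneg)
  moreover have "(1 + b)\<^sup>2 \<le> (1 + \<bar>h\<bar>)\<^sup>2" using bh b0 by (intro power_mono) auto
  then have "ln ((1 + b)\<^sup>2) \<le> ln ((1 + \<bar>h\<bar>)\<^sup>2)" using b0 by (subst ln_le_cancel_iff) auto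
  moreover have L0: "0 \<le> ln ((1 + b)\<^sup>2)" using b0 by (intro ln_ge_zero) (simp add: power2_eq_square algebra_simps)
  ultimately have mono: "b\<^sup>2 * ln ((1 + b)\<^sup>2) + 2 * b\<^sup>2 \<le> h\<^sup>2 * ln ((1 + \<bar>h\<bar>)\<^sup>2) + 2 * h\<^sup>2"
    by (intro add_mono mult_mono) auto
  have "f\<^sup>2 * ln (f\<^sup>2) - f\<^sup>2 + 1 \<le> b\<^sup>2 * ln ((1 + b)\<^sup>2) + 2 * b\<^sup>2"
  proof (cases "\<bar>f\<bar> \<ge> 1")
    case True
    then have "\<bar>f\<bar> = 1 + b" by (simp add: b_def)
    then have f2: "f\<^sup>2 = (1 + b)\<^sup>2" by (metis power2_abs)
    define L where "L = ln ((1 + b)\<^sup>2)"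
    have "L = 2 * ln (1 + b)" unfolding L_def using b0 by (simp add: ln_realpow)
    also have "\<dots> \<le> (1 + b) - 1 / (1 + b)" using ln_le_half_diff_inverse[of "1 + b"] b0 by simp
    \<comment> \<open>After substituting \<open>f^2 = (1 + b)^2\<close> and cancelling
      \<open>b^2 L\<close>, the claim reads \<open>(1 + 2 b) L <= 2 b + 3 b^2\<close>; the factor
      \<open>1 + b\<close> clears the denominator.\<close>
    finally have "(1 + 2 * b) * (1 + b) * L \<le> (1 + 2 * b) * (1 + b) * ((1 + b) - 1 / (1 + b))"
      using b0 by (intro mult_left_mono) auto
    also have "\<dots> = (1 + 2 * b) * ((1 + b) * (1 + b) - 1)" using b0 by (simp add: field_simps)
    also have "\<dots> \<le> (1 + b) * (2 * b + 3 * b\<^sup>2)"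
      using b0 by (simp add: power2_eq_square algebra_simps)
    finally have "(1 + b) * ((1 + 2 * b) * L) \<le> (1 + b) * (2 * b + 3 * b\<^sup>2)" by (simp only: mult_ac)
    then have "(1 + 2 * b) * L \<le> 2 * b + 3 * b\<^sup>2" using b0 by simp
    then show ?thesis unfolding f2 L_def[symmetric] by (simp add: power2_eq_square algebra_simps)
  next
    case False
    have "f\<^sup>2 * ln (f\<^sup>2) - f\<^sup>2 + 1 \<le> 2 * b\<^sup>2"
    proof (cases "f = 0")
      case True then show ?thesis by (simp add: b_def)
    next
      case fn: False
      define x where "x = \<bar>f\<bar>"
      have x: "0 < x" "x < 1" and bx: "b = 1 - x" and f2: "f\<^sup>2 = x\<^sup>2" using fn False by (auto simp: x_def b_def)
      have "ln (x\<^sup>2) = 2 * ln x" using x by (simp add: ln_realpow)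
      also have "\<dots> \<le> 2 * (2 * (x - 1) / (x + 1))" using ln_le_two_diff_over_sum[of x] x by linarith
      finally have "(x + 1) * x\<^sup>2 * ln (x\<^sup>2) \<le> (x + 1) * x\<^sup>2 * (2 * (2 * (x - 1) / (x + 1)))"
        using x by (intro mult_left_mono) auto
      also have "\<dots> = 4 * x\<^sup>2 * (x - 1)" using x by (simp add: field_simps)
      finally have "(x + 1) * (x\<^sup>2 * ln (x\<^sup>2)) \<le> 4 * x\<^sup>2 * (x - 1)" by (simp only: mult_ac)
      \<comment> \<open>The difference of the two sides is exactly \<open>(1 - x)^3\<close>.\<close>
      moreover have "4 * x\<^sup>2 * (x - 1) \<le> (x + 1) * (2 * (1 - x)\<^sup>2 + x\<^sup>2 - 1)"
      proof -
        have "(x + 1) * (2 * (1 - x)\<^sup>2 + x\<^sup>2 - 1) - 4 * x\<^sup>2 * (x - 1) = (1 - x) * (1 - x) * (1 - x)"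
          by (simp add: power2_eq_square algebra_simps)
        moreover have "0 \<le> (1 - x) * (1 - x) * (1 - x)" using x by simp
        ultimately show ?thesis by linarith
      qed
      ultimately have "(x + 1) * (x\<^sup>2 * ln (x\<^sup>2)) \<le> (x + 1) * (2 * (1 - x)\<^sup>2 + x\<^sup>2 - 1)" by linarith
      then have "x\<^sup>2 * ln (x\<^sup>2) \<le> 2 * (1 - x)\<^sup>2 + x\<^sup>2 - 1" using x by simp
      then show ?thesis unfolding f2 bx by simp
    qed
    then show ?thesis using L0 by (simp add: add_increasing)
  qed
  then show ?thesis using mono by linarith
qed

text \<open>Since \<open>ln 2 >= 2/3\<close>, the number 13/20 lies at least 1/60 below
  \<open>ln 2\<close>. The bound 120/61 is chosen so that half of it leaves 1/61 up to a total of
  1.\<close>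

lemma exp_13_20_le: "exp (13/20 :: real) \<le> 120 / 61"
proof -
  have "exp (13/20 :: real) = 2 * exp (13/20 - ln 2)" by (simp add: exp_diff)
  also have "\<dots> \<le> 2 * exp (- (1/60))" using ln2_ge_two_thirds by simp
  also have "\<dots> = 2 / exp (1/60)" by (simp add: exp_minus inverse_eq_divide)
  also have "\<dots> \<le> 2 / (1 + 1/60)" using exp_ge_add_one_self[of "1/60"] by (intro divide_left_mono) auto
  finally show ?thesis by simp
qed

text \<open>Needed because \<open>(1 + sqrt 2)^2 < 6\<close>; together with the coefficient 2 of
  \<open>square_entropy_le\<close> it produces 39/10.\<close>

lemma ln_6_le: "ln (6::real) \<le> 19/10"
proof -
  have "ln (6::real) = ln 2 + ln 2 + ln (1 + 1/2)"
    using ln_mult_pos[of 2 "3::real"] ln_mult_pos[of 2 "3/2::real"] by simp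
  also have "\<dots> \<le> 25/36 + 25/36 + 1/2"
    by (intro add_mono ln2_le_25_over_36 ln_add_one_self_le_self) auto
  finally show ?thesis by simp
qed

section \<open>Spectral gap and tightening\<close>

context defect_convex
begin

lemma test_fun_continuous:
  assumes "test_fun \<mu> f gf"
  shows "continuous_on UNIV f"
  using assms by (intro GDERIV_imp_continuous_on[of f gf]) (simp add: test_fun_def)

lemma test_fun_measurable:
  assumes "test_fun \<mu> f gf"
  shows "f \<in> borel_measurable borel" "gf \<in> borel_measurable borel"
  using assms test_fun_continuous[OF assms] by (auto simp: test_fun_def intro: borel_measurable_continuous_onI)

lemma test_fun_integrable:
  assumes "test_fun \<mu> f gf"
  shows "integrable \<mu> f"
proof (rule Bochner_Integration.integrable_bound)
  show "integrable \<mu> (\<lambda>x. 1 + (f x)\<^sup>2)" using assms by (simp add: test_fun_def)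
  show "f \<in> borel_measurable \<mu>" using test_fun_measurable[OF assms] by simp
  have "\<bar>y\<bar> \<le> 1 + y\<^sup>2" for y :: real
  proof -
    have "0 \<le> (\<bar>y\<bar> - 1)\<^sup>2" by simp
    also have "\<dots> = y\<^sup>2 - 2 * \<bar>y\<bar> + 1" by (simp add: power2_diff)
    finally show ?thesis using abs_ge_zero[of y] zero_le_power2[of y] by linarith
  qed
  then show "AE x in \<mu>. norm (f x) \<le> norm (1 + (f x)\<^sup>2)" by (simp add: add_nonneg_nonneg)
qed

lemma test_fun_affine:
  assumes "test_fun \<mu> f gf"
  shows "test_fun \<mu> (\<lambda>x. c * f x + m) (\<lambda>x. c *\<^sub>R gf x)"
  unfolding test_fun_def
proof (intro conjI allI)
  have f: "\<And>x. GDERIV f x :> gf x" "continuous_on UNIV gf" "integrable \<mu> (\<lambda>x. (f x)\<^sup>2)" "integrable \<mu> (\<lambda>x. (norm (gf x))\<^sup>2)"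
    using assms by (auto simp: test_fun_def)
  show "GDERIV (\<lambda>x. c * f x + m) x :> c *\<^sub>R gf x" for x
    by (rule GDERIV_subst[OF GDERIV_add[OF GDERIV_mult[OF GDERIV_const f(1)] GDERIV_const]]) simp
  show "continuous_on UNIV (\<lambda>x. c *\<^sub>R gf x)" by (intro continuous_intros f)
  show "integrable \<mu> (\<lambda>x. (norm (c *\<^sub>R gf x))\<^sup>2)" using f(4) by (simp add: power_mult_distrib)
  have "(\<lambda>x. (c * f x + m)\<^sup>2) = (\<lambda>x. c\<^sup>2 * (f x)\<^sup>2 + 2 * c * m * f x + m\<^sup>2)"
    by (auto simp: power2_eq_square algebra_simps)
  then show "integrable \<mu> (\<lambda>x. (c * f x + m)\<^sup>2)" using f(3) test_fun_integrable[OF assms] by simp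
qed

text \<open>A function supported on at most half of the mass can be tested against a \<phi> that is
  constant on its support, so the left side of the defective inequality becomes a multiple of its
  second moment. The indicator on the right is kept so that positive and negative parts can later be
  added without counting the gradient twice.\<close>

lemma pos_part_poincare:
  assumes F: "test_fun \<mu> F gF" and half: "prob {x. 0 < F x} \<le> 1/2"
  shows "(13/20 - D) * (\<integral>x. (max 0 (F x))\<^sup>2 \<partial>\<mu>) \<le> 2 / \<rho> * (\<integral>x. indicator {x. 0 < F x} x * (norm (gF x))\<^sup>2 \<partial>\<mu>)"
proof -
  have dF: "\<And>x. GDERIV F x :> gF x" and cgF: "continuous_on UNIV gF" and iF: "integrable \<mu> (\<lambda>x. (F x)\<^sup>2)"
    and igF: "integrable \<mu> (\<lambda>x. (norm (gF x))\<^sup>2)" using F by (auto simp: test_fun_def)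
  have cF: "continuous_on UNIV F" by (rule test_fun_continuous[OF F])
  have [measurable]: "F \<in> borel_measurable borel" "gF \<in> borel_measurable borel" by (rule test_fun_measurable[OF F])+
  have S[measurable]: "{x. 0 < F x} \<in> sets borel" by measurable
  \<comment> \<open>A continuously differentiable substitute for the positive part: it lies below
    it, still vanishes where \<open>F \<le> 0\<close>, and its gradient is dominated by that of
    \<open>F\<close> on \<open>{x. 0 < F x}\<close>.\<close>
  define H where "H = (\<lambda>\<delta> x. sqrt ((max 0 (F x))\<^sup>2 + \<delta>\<^sup>2) - \<delta>)"
  define gH where "gH = (\<lambda>\<delta> x. (max 0 (F x) / sqrt ((max 0 (F x))\<^sup>2 + \<delta>\<^sup>2)) *\<^sub>R gF x)"
  have H0: "0 \<le> H \<delta> x" and H1: "H \<delta> x \<le> max 0 (F x)" if "\<delta> > 0" for \<delta> x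
  proof -
    have "\<delta> \<le> sqrt ((max 0 (F x))\<^sup>2 + \<delta>\<^sup>2)" by (rule real_le_rsqrt) simp
    then show "0 \<le> H \<delta> x" by (simp add: H_def)
    have "(max 0 (F x))\<^sup>2 + \<delta>\<^sup>2 \<le> (max 0 (F x) + \<delta>)\<^sup>2" using that by (simp add: power2_eq_square algebra_simps)
    then have "sqrt ((max 0 (F x))\<^sup>2 + \<delta>\<^sup>2) \<le> max 0 (F x) + \<delta>" using that by (intro real_le_lsqrt) auto
    then show "H \<delta> x \<le> max 0 (F x)" by (simp add: H_def)
  qed
  have H2: "(H \<delta> x)\<^sup>2 \<le> (F x)\<^sup>2" if "\<delta> > 0" for \<delta> x
  proof -
    have "(H \<delta> x)\<^sup>2 \<le> (max 0 (F x))\<^sup>2" using H0[OF that] H1[OF that] by (rule power_mono[rotated])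
    also have "\<dots> \<le> (F x)\<^sup>2" by (simp add: max_def)
    finally show ?thesis .
  qed
  have gH2: "(norm (gH \<delta> x))\<^sup>2 \<le> indicator {x. 0 < F x} x * (norm (gF x))\<^sup>2" if "\<delta> > 0" for \<delta> x
  proof (cases "0 < F x")
    case True
    have "0 < sqrt ((F x)\<^sup>2 + \<delta>\<^sup>2)" using True by (simp add: add_pos_nonneg)
    moreover have "F x \<le> sqrt ((F x)\<^sup>2 + \<delta>\<^sup>2)" by (rule real_le_rsqrt) simp
    ultimately have "F x / sqrt ((F x)\<^sup>2 + \<delta>\<^sup>2) * norm (gF x) \<le> 1 * norm (gF x)"
      by (intro mult_right_mono) auto
    then have "norm (gH \<delta> x) \<le> norm (gF x)" using True by (simp add: gH_def)
    then show ?thesis using True by (simp add: power_mono)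
  next
    case False
    then show ?thesis by (simp add: gH_def)
  qed
  have sqpos: "(max 0 (F x))\<^sup>2 + \<delta>\<^sup>2 > 0" if "\<delta> > 0" for \<delta> x using that by (simp add: add_nonneg_pos)
  have tH: "test_fun \<mu> (H \<delta>) (gH \<delta>)" if d: "\<delta> > 0" for \<delta>
    unfolding test_fun_def
  proof (intro conjI allI)
    fix x
    have "((\<lambda>v. sqrt (v + \<delta>\<^sup>2) - \<delta>) has_real_derivative inverse (sqrt ((max 0 (F x))\<^sup>2 + \<delta>\<^sup>2)) / 2) (at ((max 0 (F x))\<^sup>2))"
      using sqpos[OF d, of x] by (auto intro!: derivative_eq_intros)
    from DERIV_chain2[OF this DERIV_pos_part_squared]
    have "((\<lambda>y. sqrt ((max 0 y)\<^sup>2 + \<delta>\<^sup>2) - \<delta>) has_real_derivative max 0 (F x) / sqrt ((max 0 (F x))\<^sup>2 + \<delta>\<^sup>2)) (at (F x))"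
      by (simp add: field_simps)
    from GDERIV_DERIV_compose[OF dF this] show "GDERIV (H \<delta>) x :> gH \<delta> x" unfolding H_def gH_def .
  next
    show "continuous_on UNIV (gH \<delta>)" unfolding gH_def using sqpos[OF d]
      by (intro continuous_intros cF cgF) (auto simp: less_imp_neq[THEN not_sym])
    show "integrable \<mu> (\<lambda>x. (H \<delta> x)\<^sup>2)"
      by (rule Bochner_Integration.integrable_bound[OF iF]) (use H2[OF d] in \<open>auto simp: H_def\<close>)
    show "integrable \<mu> (\<lambda>x. (norm (gH \<delta> x))\<^sup>2)"
    proof (rule Bochner_Integration.integrable_bound)
      show "integrable \<mu> (\<lambda>x. indicator {x. 0 < F x} x * (norm (gF x))\<^sup>2)"
        by (rule Bochner_Integration.integrable_bound[OF igF]) (auto split: split_indicator)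
      show "(\<lambda>x. (norm (gH \<delta> x))\<^sup>2) \<in> borel_measurable \<mu>" unfolding gH_def by measurable
      show "AE x in \<mu>. norm ((norm (gH \<delta> x))\<^sup>2) \<le> norm (indicator {x. 0 < F x} x * (norm (gF x))\<^sup>2)"
        using order_trans[OF gH2[OF d] abs_ge_self] by simp
    qed
  qed
  \<comment> \<open>The set where \<open>F\<close> is positive contributes at most
    \<open>120/61 * (1/2) = 60/61\<close> to the exponential integral, and the value
    \<open>ln (1/61)\<close> spends the remainder elsewhere, where \<open>H\<close>
    vanishes.\<close>
  define \<phi> where "\<phi> = (\<lambda>x. if 0 < F x then 13/20 else ln (1/61) :: real)"
  have phim: "\<phi> \<in> borel_measurable borel" unfolding \<phi>_def by measurable
  have phib: "\<bar>\<phi> x\<bar> \<le> max (13/20) \<bar>ln (1/61)\<bar>" for x by (simp add: \<phi>_def)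
  have phi1: "(\<integral>x. exp (\<phi> x) \<partial>\<mu>) \<le> 1"
  proof -
    have ii: "integrable \<mu> (\<lambda>x. exp (13/20) * indicator {x. 0 < F x} x :: real)"
      by (rule integrable_bounded[of _ "exp (13/20)"]) (auto split: split_indicator)
    have "(\<integral>x. exp (\<phi> x) \<partial>\<mu>) \<le> (\<integral>x. exp (13/20) * indicator {x. 0 < F x} x + 1/61 \<partial>\<mu>)"
    proof (rule integral_mono)
      show "integrable \<mu> (\<lambda>x. exp (\<phi> x))"
        by (rule integrable_bounded[of _ "exp (max (13/20) \<bar>ln (1/61)\<bar>)"])
          (use phim phib in \<open>auto intro: order_trans[OF abs_ge_self]\<close>)
      show "integrable \<mu> (\<lambda>x. exp (13/20) * indicator {x. 0 < F x} x + 1/61 :: real)" using ii by simp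
    qed (auto simp: \<phi>_def)
    also have "\<dots> = exp (13/20) * prob {x. 0 < F x} + 1/61"
      by (subst Bochner_Integration.integral_add[OF ii]) auto
    also have "\<dots> \<le> 120/61 * (1/2) + 1/61"
      using half exp_13_20_le by (intro add_mono mult_mono) auto
    finally show ?thesis by simp
  qed
  have ineq: "(13/20 - D) * (\<integral>x. (H \<delta> x)\<^sup>2 \<partial>\<mu>) \<le> 2 / \<rho> * (\<integral>x. indicator {x. 0 < F x} x * (norm (gF x))\<^sup>2 \<partial>\<mu>)" if d: "\<delta> > 0" for \<delta>
  proof -
    have eq: "13/20 * (H \<delta> x)\<^sup>2 = (H \<delta> x)\<^sup>2 * \<phi> x" for x
      using d by (auto simp: H_def \<phi>_def)
    have "13/20 * (\<integral>x. (H \<delta> x)\<^sup>2 \<partial>\<mu>) = (\<integral>x. 13/20 * (H \<delta> x)\<^sup>2 \<partial>\<mu>)" by simp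
    also have "\<dots> = (\<integral>x. (H \<delta> x)\<^sup>2 * \<phi> x \<partial>\<mu>)" by (simp only: eq)
    also have "\<dots> \<le> 2 / \<rho> * (\<integral>x. (norm (gH \<delta> x))\<^sup>2 \<partial>\<mu>) + D * (\<integral>x. (H \<delta> x)\<^sup>2 \<partial>\<mu>)"
      by (rule defective_log_sobolev[OF tH[OF d] phim phib phi1])
    also have "(\<integral>x. (norm (gH \<delta> x))\<^sup>2 \<partial>\<mu>) \<le> (\<integral>x. indicator {x. 0 < F x} x * (norm (gF x))\<^sup>2 \<partial>\<mu>)"
    proof (rule integral_mono)
      show "integrable \<mu> (\<lambda>x. indicator {x. 0 < F x} x * (norm (gF x))\<^sup>2)"
        by (rule Bochner_Integration.integrable_bound[OF igF]) (auto split: split_indicator)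
    qed (use tH[OF d] gH2[OF d] in \<open>auto simp: test_fun_def\<close>)
    finally show ?thesis using rho by (simp add: algebra_simps divide_right_mono)
  qed
  have lim: "(\<lambda>n. \<integral>x. (H (1 / real (Suc n)) x)\<^sup>2 \<partial>\<mu>) \<longlonglongrightarrow> (\<integral>x. (max 0 (F x))\<^sup>2 \<partial>\<mu>)"
  proof (rule integral_dominated_convergence[where w = "\<lambda>x. (F x)\<^sup>2"])
    have l0: "(\<lambda>n. 1 / real (Suc n)) \<longlonglongrightarrow> 0" using LIMSEQ_inverse_real_of_nat by (simp add: inverse_eq_divide)
    show "AE x in \<mu>. (\<lambda>n. (H (1 / real (Suc n)) x)\<^sup>2) \<longlonglongrightarrow> (max 0 (F x))\<^sup>2"
    proof (rule AE_I2)
      fix x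
      have "(\<lambda>n. (H (1 / real (Suc n)) x)\<^sup>2) \<longlonglongrightarrow> (sqrt ((max 0 (F x))\<^sup>2 + 0\<^sup>2) - 0)\<^sup>2"
        unfolding H_def by (intro tendsto_intros l0)
      then show "(\<lambda>n. (H (1 / real (Suc n)) x)\<^sup>2) \<longlonglongrightarrow> (max 0 (F x))\<^sup>2" by simp
    qed
    show "AE x in \<mu>. norm ((H (1 / real (Suc n)) x)\<^sup>2) \<le> (F x)\<^sup>2" for n
      using H2[of "1 / real (Suc n)"] by auto
  qed (use iF in \<open>auto simp: H_def\<close>)
  show ?thesis
    by (rule LIMSEQ_le_const2[OF tendsto_mult_left[OF lim]]) (use ineq in auto)
qed

text \<open>The sets above and below the median are disjoint, so the two localised gradient
  integrals add up to at most the full one and no factor is lost. The variance is at most the second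
  moment about any point, in particular about the median.\<close>

theorem poincare:
  assumes D1: "D < 13/20"
  shows "poincare_ineq \<mu> (2 / \<rho> / (13/20 - D))"
  unfolding poincare_ineq_def
proof (intro allI impI)
  fix f gf assume f: "test_fun \<mu> f gf"
  have f2: "integrable \<mu> (\<lambda>x. (f x)\<^sup>2)" and g2: "integrable \<mu> (\<lambda>x. (norm (gf x))\<^sup>2)" using f by (auto simp: test_fun_def)
  have if1: "integrable \<mu> f" by (rule test_fun_integrable[OF f])
  have [measurable]: "f \<in> borel_measurable borel" "gf \<in> borel_measurable borel" by (rule test_fun_measurable[OF f])+
  obtain m where m: "prob {x. m < f x} \<le> 1/2" "prob {x. f x < m} \<le> 1/2"
    using median_exists[of f] by auto
  define G where "G = (\<integral>x. (norm (gf x))\<^sup>2 \<partial>\<mu>)"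
  define I1 where "I1 = (\<integral>x. indicator {x. m < f x} x * (norm (gf x))\<^sup>2 \<partial>\<mu>)"
  define I2 where "I2 = (\<integral>x. indicator {x. f x < m} x * (norm (gf x))\<^sup>2 \<partial>\<mu>)"
  have ind: "integrable \<mu> (\<lambda>x. indicator A x * (norm (gf x))\<^sup>2)" if "A \<in> sets borel" for A
    by (rule Bochner_Integration.integrable_bound[OF g2]) (use that in \<open>auto split: split_indicator\<close>)
  have 1: "(13/20 - D) * (\<integral>x. (max 0 (f x - m))\<^sup>2 \<partial>\<mu>) \<le> 2 / \<rho> * I1"
    using pos_part_poincare[OF test_fun_affine[OF f, of 1 "- m"]] m unfolding I1_def by simp
  have 2: "(13/20 - D) * (\<integral>x. (max 0 (m - f x))\<^sup>2 \<partial>\<mu>) \<le> 2 / \<rho> * I2"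
    using pos_part_poincare[OF test_fun_affine[OF f, of "-1" m]] m unfolding I2_def by simp
  have "I1 + I2 = (\<integral>x. indicator {x. m < f x} x * (norm (gf x))\<^sup>2 + indicator {x. f x < m} x * (norm (gf x))\<^sup>2 \<partial>\<mu>)"
    unfolding I1_def I2_def using ind by simp
  also have "\<dots> \<le> G" unfolding G_def
    by (rule integral_mono) (use ind g2 in \<open>auto split: split_indicator\<close>)
  finally have I: "I1 + I2 \<le> G" .
  have fm: "integrable \<mu> (\<lambda>x. (f x - m)\<^sup>2)"
    using test_fun_affine[OF f, of 1 "- m"] by (simp add: test_fun_def)
  have im: "integrable \<mu> (\<lambda>x. (max 0 (f x - m))\<^sup>2)" "integrable \<mu> (\<lambda>x. (max 0 (m - f x))\<^sup>2)"
    by (rule Bochner_Integration.integrable_bound[OF fm]; auto simp: max_def power2_commute)+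
  have "(\<integral>x. (f x - m)\<^sup>2 \<partial>\<mu>) = (\<integral>x. (max 0 (f x - m))\<^sup>2 + (max 0 (m - f x))\<^sup>2 \<partial>\<mu>)"
    by (intro Bochner_Integration.integral_cong) (auto simp: max_def power2_commute)
  also have "\<dots> = (\<integral>x. (max 0 (f x - m))\<^sup>2 \<partial>\<mu>) + (\<integral>x. (max 0 (m - f x))\<^sup>2 \<partial>\<mu>)"
    using im by simp
  finally have "(13/20 - D) * (\<integral>x. (f x - m)\<^sup>2 \<partial>\<mu>) \<le> 2 / \<rho> * (I1 + I2)"
    using 1 2 by (simp only: distrib_left)
  also have "\<dots> \<le> 2 / \<rho> * G" using I rho by (intro mult_left_mono) auto
  finally have "(\<integral>x. (f x - m)\<^sup>2 \<partial>\<mu>) * (13/20 - D) \<le> 2 / \<rho> * G" by (subst mult.commute)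
  then have "(\<integral>x. (f x - m)\<^sup>2 \<partial>\<mu>) \<le> (2 / \<rho> * G) / (13/20 - D)"
    using D1 by (subst pos_le_divide_eq) auto
  then have 3: "(\<integral>x. (f x - m)\<^sup>2 \<partial>\<mu>) \<le> 2 / \<rho> / (13/20 - D) * G" by simp
  have "(\<integral>x. (f x - m)\<^sup>2 \<partial>\<mu>) = (\<integral>x. (f x)\<^sup>2 + (- (2 * m)) * f x + m\<^sup>2 \<partial>\<mu>)"
    by (intro Bochner_Integration.integral_cong) (auto simp: power2_eq_square algebra_simps)
  also have "\<dots> = (\<integral>x. (f x)\<^sup>2 \<partial>\<mu>) + (- (2 * m)) * (\<integral>x. f x \<partial>\<mu>) + m\<^sup>2"
    using f2 if1 by simp
  also have "\<dots> = (\<integral>x. (f x)\<^sup>2 \<partial>\<mu>) - (\<integral>x. f x \<partial>\<mu>)\<^sup>2 + ((\<integral>x. f x \<partial>\<mu>) - m)\<^sup>2"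
    by (simp add: power2_eq_square algebra_simps)
  finally have "(\<integral>x. (f x)\<^sup>2 \<partial>\<mu>) - (\<integral>x. f x \<partial>\<mu>)\<^sup>2 \<le> (\<integral>x. (f x - m)\<^sup>2 \<partial>\<mu>)"
    using zero_le_power2[of "(\<integral>x. f x \<partial>\<mu>) - m"] by linarith
  then show "(\<integral>x. (f x)\<^sup>2 \<partial>\<mu>) - (\<integral>x. f x \<partial>\<mu>)\<^sup>2 \<le> 2 / \<rho> / (13/20 - D) * (\<integral>x. (norm (gf x))\<^sup>2 \<partial>\<mu>)"
    using 3 unfolding G_def by linarith
qed

text \<open>As \<open>f^2\<close> integrates to 1, the integral of \<Phi> is the entropy. The
  pointwise bound moves it to \<open>h = f - 1\<close>, whose logarithmic term is handled by the
  defective inequality with \<phi> close to \<open>ln ((1 + \<bar>h\<bar>)^2) - ln W\<close>. The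
  price is \<open>ln W + 2 <= 39/10\<close> times \<open>v\<close>, besides the defect
  \<open>D v\<close>.\<close>

lemma log_sobolev_normalized:
  assumes f: "test_fun \<mu> f gf" and fl: "integrable \<mu> (\<lambda>x. (f x)\<^sup>2 * ln ((f x)\<^sup>2))"
    and one: "(\<integral>x. (f x)\<^sup>2 \<partial>\<mu>) = 1" and pos: "(\<integral>x. f x \<partial>\<mu>) \<ge> 0"
  shows "(\<integral>x. (f x)\<^sup>2 * ln ((f x)\<^sup>2) \<partial>\<mu>)
    \<le> 2 / \<rho> * (\<integral>x. (norm (gf x))\<^sup>2 \<partial>\<mu>) + (D + 39/10) * (2 * ((\<integral>x. (f x)\<^sup>2 \<partial>\<mu>) - (\<integral>x. f x \<partial>\<mu>)\<^sup>2))"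
proof -
  have f2: "integrable \<mu> (\<lambda>x. (f x)\<^sup>2)" using f by (simp add: test_fun_def)
  have if1: "integrable \<mu> f" by (rule test_fun_integrable[OF f])
  have [measurable]: "f \<in> borel_measurable borel" by (rule test_fun_measurable[OF f])
  define h where "h = (\<lambda>x. f x - 1)"
  have [measurable]: "h \<in> borel_measurable borel" by (simp add: h_def)
  have th: "test_fun \<mu> h gf" using test_fun_affine[OF f, of 1 "- 1"] by (simp add: h_def)
  have h2: "integrable \<mu> (\<lambda>x. (h x)\<^sup>2)" using th by (simp add: test_fun_def)
  have ih: "integrable \<mu> (\<lambda>x. \<bar>h x\<bar>)" using test_fun_integrable[OF th] by simp
  define m where "m = (\<integral>x. f x \<partial>\<mu>)"
  define v where "v = (\<integral>x. (h x)\<^sup>2 \<partial>\<mu>)"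
  have "v = (\<integral>x. (f x)\<^sup>2 + (- 2) * f x + 1 \<partial>\<mu>)"
    unfolding v_def h_def by (intro Bochner_Integration.integral_cong) (auto simp: power2_eq_square algebra_simps)
  also have "\<dots> = (\<integral>x. (f x)\<^sup>2 \<partial>\<mu>) + (- 2) * m + 1" using f2 if1 by (simp add: m_def)
  finally have v: "v = 2 - 2 * m" using one by simp
  have v0: "v \<ge> 0" by (simp add: v_def)
  \<comment> \<open>Nonnegativity of \<open>v = 2 - 2 m\<close> gives \<open>m \<le> 1\<close>. With
    \<open>m \<ge> 0\<close> this yields \<open>m^2 <= m\<close>, so \<open>v\<close> is at most
    twice the variance.\<close>
  have "m * m \<le> m * 1" using v v0 pos unfolding m_def[symmetric] by (intro mult_left_mono) auto
  then have vv: "v \<le> 2 * (1 - m\<^sup>2)" using v by (simp add: power2_eq_square)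
  have v2: "v \<le> 2" using v pos by (simp add: m_def)
  \<comment> \<open>By Cauchy-Schwarz \<open>W\<close> bounds the integral of
    \<open>(1 + \<bar>h\<bar>)^2\<close>, so subtracting \<open>ln W\<close> makes the dual test
    function admissible.\<close>
  define W where "W = (1 + sqrt v)\<^sup>2"
  have W1: "W \<ge> 1" unfolding W_def using v0 by simp
  have lnW: "ln W \<le> 19/10"
  proof -
    have "sqrt v \<le> 3/2" using v2 by (intro real_le_lsqrt) (auto simp: v0 power2_eq_square)
    then have "W \<le> 6" unfolding W_def using v0 v2 by (simp add: power2_eq_square algebra_simps)
    then have "ln W \<le> ln 6" using W1 by simp
    then show ?thesis using ln_6_le by simp
  qed
  have int1: "(\<integral>x. (1 + \<bar>h x\<bar>)\<^sup>2 \<partial>\<mu>) \<le> W"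
  proof -
    have e: "(1 + \<bar>h x\<bar>)\<^sup>2 = 1 + 2 * \<bar>h x\<bar> + (h x)\<^sup>2" for x by (simp add: power2_eq_square algebra_simps)
    define a where "a = (\<integral>x. \<bar>h x\<bar> \<partial>\<mu>)"
    have "0 \<le> (\<integral>x. (\<bar>h x\<bar> - a)\<^sup>2 \<partial>\<mu>)" by simp
    also have "\<dots> = (\<integral>x. (h x)\<^sup>2 + (- (2 * a)) * \<bar>h x\<bar> + a\<^sup>2 \<partial>\<mu>)"
      by (intro Bochner_Integration.integral_cong) (auto simp: power2_eq_square algebra_simps)
    also have "\<dots> = v - a\<^sup>2" using h2 ih by (simp add: v_def a_def power2_eq_square)
    finally have "a \<le> sqrt v" by (intro real_le_rsqrt) simp
    moreover have "(\<integral>x. (1 + \<bar>h x\<bar>)\<^sup>2 \<partial>\<mu>) = 1 + 2 * a + v" unfolding e using h2 ih by (simp add: a_def v_def)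
    ultimately show ?thesis unfolding W_def using v0 by (simp add: power2_eq_square algebra_simps)
  qed
  have i1: "integrable \<mu> (\<lambda>x. (1 + \<bar>h x\<bar>)\<^sup>2)"
  proof -
    have "(\<lambda>x. (1 + \<bar>h x\<bar>)\<^sup>2) = (\<lambda>x. 1 + 2 * \<bar>h x\<bar> + (h x)\<^sup>2)" by (auto simp: power2_eq_square algebra_simps)
    then show ?thesis using h2 ih by simp
  qed
  define \<Phi> where "\<Phi> = (\<lambda>x. (f x)\<^sup>2 * ln ((f x)\<^sup>2) - (f x)\<^sup>2 + 1)"
  have iPhi: "integrable \<mu> \<Phi>" unfolding \<Phi>_def using fl f2 by simp
  have [measurable]: "\<Phi> \<in> borel_measurable borel" by (simp add: \<Phi>_def)
  define R where "R = 2 / \<rho> * (\<integral>x. (norm (gf x))\<^sup>2 \<partial>\<mu>) + (D + 39/10) * v"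
  \<comment> \<open>The dual test function must be bounded, so the logarithm is capped and the
    integrand restricted to points where the cap is inactive. \<open>Suc n\<close> keeps the cap at
    least 1 for \<open>n = 0\<close> as well, hence the capped logarithm nonnegative.\<close>
  define B where "B = (\<lambda>n::nat. {x. (1 + \<bar>h x\<bar>)\<^sup>2 \<le> real (Suc n)})"
  have [measurable]: "B n \<in> sets borel" for n unfolding B_def by measurable
  have trunc: "(\<integral>x. indicator (B n) x * \<Phi> x \<partial>\<mu>) \<le> R" for n
  proof -
    define w where "w = (\<lambda>x. min ((1 + \<bar>h x\<bar>)\<^sup>2) (real (Suc n)))"
    have [measurable]: "w \<in> borel_measurable borel" by (simp add: w_def)
    have w1: "1 \<le> w x" and wn: "w x \<le> real (Suc n)" for x by (auto simp: w_def)
    define \<phi> where "\<phi> = (\<lambda>x. ln (w x) - ln W)"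
    have phim: "\<phi> \<in> borel_measurable borel" by (simp add: \<phi>_def)
    have lw: "0 \<le> ln (w x)" "ln (w x) \<le> ln (real (Suc n))" for x
      using w1[of x] wn[of x] by (auto intro!: ln_ge_zero iffD2[OF ln_le_cancel_iff])
    have phib: "\<bar>\<phi> x\<bar> \<le> ln (real (Suc n)) + ln W" for x
      using lw[of x] ln_ge_zero[OF W1] by (simp add: \<phi>_def abs_le_iff)
    have ephi: "exp (\<phi> x) = w x / W" for x using w1[of x] W1 by (simp add: \<phi>_def exp_diff)
    have phi1: "(\<integral>x. exp (\<phi> x) \<partial>\<mu>) \<le> 1"
    proof -
      have "(\<integral>x. w x \<partial>\<mu>) \<le> (\<integral>x. (1 + \<bar>h x\<bar>)\<^sup>2 \<partial>\<mu>)"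
      proof (rule integral_mono)
        show "integrable \<mu> w"
        proof (rule integrable_bounded[of _ "real (Suc n)"])
          show "\<bar>w x\<bar> \<le> real (Suc n)" for x using w1[of x] wn[of x] by linarith
        qed simp
      qed (use i1 in \<open>auto simp: w_def\<close>)
      also note int1
      finally show ?thesis unfolding ephi using W1 by simp
    qed
    have hw: "integrable \<mu> (\<lambda>x. (h x)\<^sup>2 * ln (w x))"
    proof (rule Bochner_Integration.integrable_bound)
      show "integrable \<mu> (\<lambda>x. (h x)\<^sup>2 * ln (real (Suc n)))" using h2 by simp
      show "AE x in \<mu>. norm ((h x)\<^sup>2 * ln (w x)) \<le> norm ((h x)\<^sup>2 * ln (real (Suc n)))"
        using lw by (auto intro!: mult_left_mono simp: abs_mult)
    qed simp
    have "(\<integral>x. indicator (B n) x * \<Phi> x \<partial>\<mu>) \<le> (\<integral>x. (h x)\<^sup>2 * ln (w x) + 2 * (h x)\<^sup>2 \<partial>\<mu>)"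
    proof (rule integral_mono)
      show "integrable \<mu> (\<lambda>x. indicator (B n) x * \<Phi> x)"
        by (rule Bochner_Integration.integrable_bound[OF iPhi]) (auto split: split_indicator)
      show "integrable \<mu> (\<lambda>x. (h x)\<^sup>2 * ln (w x) + 2 * (h x)\<^sup>2)" using hw h2 by simp
      fix x
      show "indicator (B n) x * \<Phi> x \<le> (h x)\<^sup>2 * ln (w x) + 2 * (h x)\<^sup>2"
      proof (cases "x \<in> B n")
        case True
        then have "w x = (1 + \<bar>h x\<bar>)\<^sup>2" by (simp add: w_def B_def)
        then show ?thesis using True square_entropy_le[of "f x"] by (simp add: \<Phi>_def h_def)
      next
        case False
        then show ?thesis using lw[of x] by simp
      qed
    qed
    also have "\<dots> = (\<integral>x. (h x)\<^sup>2 * \<phi> x + (ln W + 2) * (h x)\<^sup>2 \<partial>\<mu>)"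
      by (intro Bochner_Integration.integral_cong) (auto simp: \<phi>_def algebra_simps)
    also have "\<dots> = (\<integral>x. (h x)\<^sup>2 * \<phi> x \<partial>\<mu>) + (ln W + 2) * v"
    proof -
      have "integrable \<mu> (\<lambda>x. (h x)\<^sup>2 * \<phi> x)" using hw h2 by (simp add: \<phi>_def right_diff_distrib)
      then show ?thesis using h2 by (simp add: v_def)
    qed
    also have "\<dots> \<le> (2 / \<rho> * (\<integral>x. (norm (gf x))\<^sup>2 \<partial>\<mu>) + D * v) + (19/10 + 2) * v"
      using defective_log_sobolev[OF th phim phib phi1] lnW v0
      by (intro add_mono mult_right_mono) (auto simp: v_def)
    also have "\<dots> = R" by (simp add: R_def algebra_simps)
    finally show ?thesis .
  qed
  have lim: "(\<lambda>n. \<integral>x. indicator (B n) x * \<Phi> x \<partial>\<mu>) \<longlonglongrightarrow> (\<integral>x. \<Phi> x \<partial>\<mu>)"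
  proof (rule integral_dominated_convergence[where w = "\<lambda>x. \<bar>\<Phi> x\<bar>"])
    show "AE x in \<mu>. (\<lambda>n. indicator (B n) x * \<Phi> x) \<longlonglongrightarrow> \<Phi> x"
    proof (rule AE_I2)
      fix x
      obtain N where N: "(1 + \<bar>h x\<bar>)\<^sup>2 \<le> real N" using real_arch_simple by blast
      have "indicator (B n) x * \<Phi> x = \<Phi> x" if "n \<ge> N" for n
      proof -
        have "x \<in> B n" using N that by (simp add: B_def)
        then show ?thesis by simp
      qed
      then show "(\<lambda>n. indicator (B n) x * \<Phi> x) \<longlonglongrightarrow> \<Phi> x"
        by (intro tendsto_eventually eventually_sequentiallyI)
    qed
    show "AE x in \<mu>. norm (indicator (B n) x * \<Phi> x) \<le> \<bar>\<Phi> x\<bar>" for n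
      by (auto split: split_indicator)
  qed (use iPhi in auto)
  have "(\<integral>x. \<Phi> x \<partial>\<mu>) \<le> R" by (rule LIMSEQ_le_const2[OF lim]) (use trunc in auto)
  moreover have "(\<integral>x. \<Phi> x \<partial>\<mu>) = (\<integral>x. (f x)\<^sup>2 * ln ((f x)\<^sup>2) \<partial>\<mu>)"
    unfolding \<Phi>_def using fl f2 one by simp
  moreover have "(D + 39/10) * v \<le> (D + 39/10) * (2 * (1 - m\<^sup>2))" using vv D by (intro mult_left_mono) auto
  ultimately show ?thesis unfolding R_def one m_def by linarith
qed

theorem log_sobolev:
  assumes D1: "D < 13/20"
  shows "log_sobolev_ineq \<mu> (2 / \<rho> + (D + 39/10) * (2 * (2 / \<rho> / (13/20 - D))))"
  unfolding log_sobolev_ineq_def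
proof (intro allI impI)
  fix f gf assume f: "test_fun \<mu> f gf" and fl: "integrable \<mu> (\<lambda>x. (f x)\<^sup>2 * ln ((f x)\<^sup>2))"
  define CP where "CP = 2 / \<rho> / (13/20 - D)"
  define C where "C = 2 / \<rho> + (D + 39/10) * (2 * CP)"
  have CP: "CP \<ge> 0" unfolding CP_def using rho D1 by simp
  have C: "C \<ge> 0" unfolding C_def using rho D CP by simp
  define G where "G = (\<integral>x. (norm (gf x))\<^sup>2 \<partial>\<mu>)"
  have G: "G \<ge> 0" by (simp add: G_def)
  have f2: "integrable \<mu> (\<lambda>x. (f x)\<^sup>2)" using f by (simp add: test_fun_def)
  define S where "S = (\<integral>x. (f x)\<^sup>2 \<partial>\<mu>)"
  have "(\<integral>x. (f x)\<^sup>2 * ln ((f x)\<^sup>2) \<partial>\<mu>) - S * ln S \<le> C * G"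
  proof (cases "S = 0")
    case True
    then have "AE x in \<mu>. (f x)\<^sup>2 = 0" unfolding S_def using integral_nonneg_eq_0_iff_AE[OF f2] by simp
    then have "AE x in \<mu>. (f x)\<^sup>2 * ln ((f x)\<^sup>2) = 0" by eventually_elim simp
    then have "(\<integral>x. (f x)\<^sup>2 * ln ((f x)\<^sup>2) \<partial>\<mu>) = 0" by (rule integral_eq_zero_AE)
    then show ?thesis using True C G by simp
  next
    case False
    moreover have "S \<ge> 0" by (simp add: S_def)
    ultimately have S: "S > 0" by simp
    \<comment> \<open>The modulus normalises the second moment and the sign makes the mean
      nonnegative. Entropy and gradient energy both scale by \<open>c^2 = 1 / S\<close>.\<close>
    define c where "c = (if (\<integral>x. f x \<partial>\<mu>) \<ge> 0 then 1 / sqrt S else - (1 / sqrt S))"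
    have c2: "c\<^sup>2 = 1 / S" using S by (simp add: c_def power_divide)
    have tf: "test_fun \<mu> (\<lambda>x. c * f x) (\<lambda>x. c *\<^sub>R gf x)" using test_fun_affine[OF f, of c 0] by simp
    have e: "(c * f x)\<^sup>2 * ln ((c * f x)\<^sup>2) = 1 / S * ((f x)\<^sup>2 * ln ((f x)\<^sup>2) - ln S * (f x)\<^sup>2)" for x
    proof (cases "f x = 0")
      case False
      have "ln ((c * f x)\<^sup>2) = ln ((f x)\<^sup>2) - ln S"
        using S False by (simp add: power_mult_distrib c2 ln_div)
      then show ?thesis by (simp add: power_mult_distrib c2 right_diff_distrib mult.commute)
    qed simp
    have fl': "integrable \<mu> (\<lambda>x. (c * f x)\<^sup>2 * ln ((c * f x)\<^sup>2))" unfolding e using fl f2 by simp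
    have "(\<integral>x. (c * f x)\<^sup>2 \<partial>\<mu>) = 1" using S by (simp add: power_mult_distrib c2 S_def)
    moreover have "(\<integral>x. c * f x \<partial>\<mu>) \<ge> 0" using S by (simp add: c_def divide_nonpos_nonneg)
    ultimately have "(\<integral>x. (c * f x)\<^sup>2 * ln ((c * f x)\<^sup>2) \<partial>\<mu>)
      \<le> 2 / \<rho> * (\<integral>x. (norm (c *\<^sub>R gf x))\<^sup>2 \<partial>\<mu>) + (D + 39/10) * (2 * ((\<integral>x. (c * f x)\<^sup>2 \<partial>\<mu>) - (\<integral>x. c * f x \<partial>\<mu>)\<^sup>2))"
      by (rule log_sobolev_normalized[OF tf fl'])
    also have "\<dots> \<le> 2 / \<rho> * (\<integral>x. (norm (c *\<^sub>R gf x))\<^sup>2 \<partial>\<mu>) + (D + 39/10) * (2 * (CP * (\<integral>x. (norm (c *\<^sub>R gf x))\<^sup>2 \<partial>\<mu>)))"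
      using D by (intro add_left_mono mult_left_mono
          poincare[OF D1, folded CP_def, unfolded poincare_ineq_def, rule_format, OF tf]) auto
    also have "\<dots> = C * (\<integral>x. (norm (c *\<^sub>R gf x))\<^sup>2 \<partial>\<mu>)" by (simp add: C_def algebra_simps)
    also have "(\<integral>x. (norm (c *\<^sub>R gf x))\<^sup>2 \<partial>\<mu>) = 1 / S * G" by (simp add: power_mult_distrib c2 G_def)
    also have "(\<integral>x. (c * f x)\<^sup>2 * ln ((c * f x)\<^sup>2) \<partial>\<mu>) = 1 / S * ((\<integral>x. (f x)\<^sup>2 * ln ((f x)\<^sup>2) \<partial>\<mu>) - ln S * S)"
      unfolding e using fl f2 by (simp add: S_def)
    finally have "((\<integral>x. (f x)\<^sup>2 * ln ((f x)\<^sup>2) \<partial>\<mu>) - ln S * S) / S \<le> C * G / S" by simp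
    then show ?thesis using S by (simp add: divide_le_cancel mult.commute)
  qed
  then show "(\<integral>x. (f x)\<^sup>2 * ln ((f x)\<^sup>2) \<partial>\<mu>) - (\<integral>x. (f x)\<^sup>2 \<partial>\<mu>) * ln (\<integral>x. (f x)\<^sup>2 \<partial>\<mu>)
     \<le> (2 / \<rho> + (D + 39/10) * (2 * (2 / \<rho> / (13/20 - D)))) * (\<integral>x. (norm (gf x))\<^sup>2 \<partial>\<mu>)"
    unfolding S_def G_def C_def CP_def .
qed

end

section \<open>Numerical constants and the choice of \<epsilon>\<close>

lemma poincare_ineq_mono:
  assumes "poincare_ineq M C" "C \<le> C'"
  shows "poincare_ineq M C'"
  using assms unfolding poincare_ineq_def
  by (meson Bochner_Integration.integral_nonneg mult_right_mono order_trans zero_le_power2)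

lemma log_sobolev_ineq_mono:
  assumes "log_sobolev_ineq M C" "C \<le> C'"
  shows "log_sobolev_ineq M C'"
  using assms unfolding log_sobolev_ineq_def
  by (meson Bochner_Integration.integral_nonneg mult_right_mono order_trans zero_le_power2)

text \<open>Here \<open>2 / \<rho> = 20 / (9 \<kappa>)\<close> and \<open>13/20 - D >= 3/5\<close>.
  The Poincare constant is at most \<open>100 / (27 \<kappa>)\<close>, and the logarithmic Sobolev
  constant at most \<open>850 / (27 \<kappa>)\<close>, just below
  \<open>32 / \<kappa>\<close>.\<close>

lemma poincare_log_sobolev_of_gradient_gap:
  fixes U :: "real^'n::finite \<Rightarrow> real" and gU :: "real^'n \<Rightarrow> real^'n"
  assumes grad: "\<And>x. GDERIV U x :> gU x"
    and int: "integrable lborel (\<lambda>x. exp (- U x))"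
    and mono: "\<And>x y. (gU x - gU y) \<bullet> (x - y) \<ge> 0"
    and conv: "\<And>x y. (gU x - gU y) \<bullet> (x - y) \<ge> \<kappa> * ((norm (x - y))\<^sup>2 - \<epsilon>)"
    and k: "\<kappa> > 0" and e: "\<epsilon> > 0" and small: "\<kappa> * \<epsilon> \<le> 1/100"
  shows "poincare_ineq (gibbs U) (4 / \<kappa>)" "log_sobolev_ineq (gibbs U) (32 / \<kappa>)"
proof -
  interpret defect_convex U "9/10 * \<kappa>" "5 * \<kappa> * \<epsilon>"
  proof
    show "continuous_on UNIV U" by (rule GDERIV_imp_continuous_on[OF grad])
    fix t s :: real and z h :: "real^'n" assume "t > 0" "s > 0" "t + s = 1"
    then show "t * s * (9 / 10 * \<kappa> * (norm h)\<^sup>2 / 2 - 5 * \<kappa> * \<epsilon>) \<le> t * U (z + s *\<^sub>R h) + s * U (z - t *\<^sub>R h) - U z"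
      using convexity_defect[OF grad mono conv] k e by simp
  qed (use int k e in auto)
  define d where "d = 5 * \<kappa> * \<epsilon>"
  have d: "d \<le> 1/20" "0 \<le> d" using small k e by (auto simp: d_def)
  define A where "A = 2 / (9/10 * \<kappa>)"
  have A: "A = 20/9 / \<kappa>" "A \<ge> 0" using k by (simp_all add: A_def)
  have P: "A / (13/20 - d) \<le> A / (3/5)" using d A by (intro divide_left_mono) auto
  have "A / (3/5) \<le> 4 / \<kappa>" unfolding A(1) using k by (simp add: field_simps)
  with P have 1: "A / (13/20 - d) \<le> 4 / \<kappa>" by (rule order_trans)
  have "A + (d + 39/10) * (2 * (A / (13/20 - d))) \<le> A + (1/20 + 39/10) * (2 * (A / (3/5)))"
    using d A P by (intro add_mono mult_mono) auto
  also have "\<dots> \<le> 32 / \<kappa>" unfolding A(1) using k by (simp add: field_simps)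
  finally have 2: "A + (d + 39/10) * (2 * (A / (13/20 - d))) \<le> 32 / \<kappa>" .
  show "poincare_ineq (gibbs U) (4 / \<kappa>)"
    using poincare_ineq_mono[OF poincare 1[unfolded A_def d_def]] d by (simp add: d_def)
  show "log_sobolev_ineq (gibbs U) (32 / \<kappa>)"
    using log_sobolev_ineq_mono[OF log_sobolev 2[unfolded A_def d_def]] d by (simp add: d_def)
qed

theorem theorem5p12:
  fixes U :: "real^'n::finite \<Rightarrow> real" and gU :: "real^'n \<Rightarrow> real^'n"
    and \<beta> K :: real
  assumes smooth: "smooth_fun U"
    and grad: "\<And>x. GDERIV U x :> gU x"
    and prob: "integrable lborel (\<lambda>x. exp (- U x))"
    and beta: "\<beta> \<ge> 1" and K: "K > 0"
    and conv: "\<And>x y \<epsilon>. \<epsilon> > 0 \<Longrightarrow>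
       (gU x - gU y) \<bullet> (x - y) \<ge> K * min (\<epsilon> powr \<beta>) 1 * ((norm (x - y))\<^sup>2 - \<epsilon>)"
  shows "poincare_ineq (gibbs U)
           (max (32 / K) (4 * 36 powr ((2*\<beta>+1)/(\<beta>+1)) * (32 / K\<^sup>2) powr (1 / (2*(\<beta>+1)))))
       \<and> log_sobolev_ineq (gibbs U)
           (max (32 / K) ((32 / K\<^sup>2) powr (1 / (2*(\<beta>+1))) *
              (4 powr ((3*\<beta>+1)/(2*\<beta>+1)) * 36 powr (\<beta>/(\<beta>+1)) + 8 * 36 powr ((2*\<beta>+1)/(\<beta>+1)))))"
proof -
  have mono: "(gU x - gU y) \<bullet> (x - y) \<ge> 0" for x y
    using conv[of "(norm (x - y))\<^sup>2" x y] by (cases "x = y") auto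
  show ?thesis
  proof (cases "K \<le> 1/100")
    case True
    have c1: "(gU x - gU y) \<bullet> (x - y) \<ge> K * ((norm (x - y))\<^sup>2 - 1)" for x y
      using conv[of 1 x y] by simp
    have "poincare_ineq (gibbs U) (4 / K)" "log_sobolev_ineq (gibbs U) (32 / K)"
      by (rule poincare_log_sobolev_of_gradient_gap[OF grad prob mono c1]; use K True in simp)+
    moreover have "4 / K \<le> 32 / K" using K by (simp add: divide_right_mono)
    ultimately show ?thesis
      by (meson poincare_ineq_mono log_sobolev_ineq_mono max.coboundedI1 order_refl)
  next
    case False
    define p where "p = 1 / (\<beta> + 1)"
    have p: "0 < p" "p \<le> 1" and pb: "p * (\<beta> + 1) = 1" using beta by (auto simp: p_def)
    define \<epsilon> where "\<epsilon> = (1 / (100 * K)) powr p"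
    have e: "\<epsilon> > 0" using K by (simp add: \<epsilon>_def)
    have eb: "K * (\<epsilon> powr \<beta>) * \<epsilon> = 1/100"
    proof -
      have "\<epsilon> powr \<beta> * \<epsilon> = \<epsilon> powr (\<beta> + 1)" using e by (simp add: powr_add)
      also have "\<dots> = 1 / (100 * K)" using K pb by (simp add: \<epsilon>_def powr_powr)
      finally show ?thesis using K by (simp add: mult.assoc)
    qed
    have "\<epsilon> \<le> 1 powr p" unfolding \<epsilon>_def using False K p by (intro powr_mono2) (auto simp: field_simps)
    then have "\<epsilon> powr \<beta> \<le> 1 powr \<beta>" using e beta by (intro powr_mono2) auto
    then have m: "min (\<epsilon> powr \<beta>) 1 = \<epsilon> powr \<beta>" by simp
    define \<kappa> where "\<kappa> = K * \<epsilon> powr \<beta>"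
    have k: "\<kappa> > 0" using K e by (simp add: \<kappa>_def)
    have ke: "\<kappa> * \<epsilon> = 1/100" using eb by (simp add: \<kappa>_def)
    have c1: "(gU x - gU y) \<bullet> (x - y) \<ge> \<kappa> * ((norm (x - y))\<^sup>2 - \<epsilon>)" for x y
      using conv[OF e, of x y] unfolding m \<kappa>_def .
    have PL: "poincare_ineq (gibbs U) (4 / \<kappa>)" "log_sobolev_ineq (gibbs U) (32 / \<kappa>)"
      by (rule poincare_log_sobolev_of_gradient_gap[OF grad prob mono c1 k e]; use ke in simp)+
    have inv: "1 / \<kappa> = 100 * \<epsilon>" using ke k by (simp add: field_simps)
    define T where "T = (32 / K\<^sup>2) powr (1 / (2*(\<beta>+1)))"
    define B where "B = (36::real) powr ((2*\<beta>+1)/(\<beta>+1))"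
    have T: "K powr (- p) \<le> T"
    proof -
      have "K powr (- p) = (1 / K\<^sup>2) powr (p / 2)"
        using K by (simp add: powr_divide powr_minus_divide powr_powr flip: powr_numeral)
      also have "\<dots> \<le> (32 / K\<^sup>2) powr (p / 2)" using K p by (intro powr_mono2) (auto simp: divide_right_mono)
      also have "p / 2 = 1 / (2*(\<beta>+1))" by (simp add: p_def)
      finally show ?thesis by (simp add: T_def)
    qed
    have B: "1296 * 36 powr (- p) = B"
    proof -
      have "(2*\<beta>+1)/(\<beta>+1) = 2 + (- p)" unfolding p_def using beta by (simp add: field_simps)
      then have "B = 36 powr 2 * 36 powr (- p)" by (simp only: B_def powr_add)
      then show ?thesis by simp
    qed
    have "\<epsilon> = 100 powr (- p) * K powr (- p)"
      unfolding \<epsilon>_def using K by (simp add: powr_divide powr_mult powr_minus_divide)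
    also have "\<dots> \<le> 36 powr (- p) * T"
      using T p by (intro mult_mono powr_mono2') auto
    finally have "1296 * \<epsilon> \<le> B * T" using B by (simp add: mult.assoc flip: B)
    moreover have "T \<ge> 0" "B \<ge> 0" by (auto simp: T_def B_def)
    moreover define Q where "Q = (4::real) powr ((3*\<beta>+1)/(2*\<beta>+1)) * 36 powr (\<beta>/(\<beta>+1))"
    then have "T * Q \<ge> 0" by (simp add: T_def)
    moreover have "4 / \<kappa> = 400 * \<epsilon>" "32 / \<kappa> = 3200 * \<epsilon>" using inv by (simp_all add: field_simps)
    moreover have "T * (Q + 8 * B) = T * Q + 8 * (B * T)" "4 * B * T = 4 * (B * T)" by (simp_all add: algebra_simps)
    ultimately have "4 / \<kappa> \<le> 4 * B * T" "32 / \<kappa> \<le> T * (Q + 8 * B)"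
      using e by linarith+
    then show ?thesis
      using PL unfolding B_def T_def Q_def
      by (meson poincare_ineq_mono log_sobolev_ineq_mono max.coboundedI2)
  qed
qed

end
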